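(* For every $\varepsilon>0$ there is $d_0=d_0(\varepsilon)$ such that, for every $d\ge d_0$, \[ \lim_{n\to\infty}\mathbb{P}\left( \log c(G(n,d/n))\le\frac{\pi^2/6+\varepsilon}{d} \right)=1. \]
   Context: For a finite graph $G=(V,E)$ with connected components $C_1,\dots,C_k$, fix a root $r_i\in C_i$ in each component and let \[ P_G=\{x\in\mathbb{R}^V: x(r_i)=0 \text{ for all } i,\ |x(u)-x(v)|\le 1 \text{ for all } uv\in E\}. \] The growth constant $c(G)>0$ is defined by $c(G)^{|V|-k}=\mathrm{Vol}(P_G)$ (volume in the coordinate space of the non-root vertices; independent of the choice of roots). $G(n,d/n)$ is the Erdős–Rényi random graph on $[n]$ with edge probability $d/n$. *)

theory Defs
  imports "HOL-Probability.Probability"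
begin

type_synonym 'a ugraph = "'a set \<times> 'a set set"

abbreviation verts :: "'a ugraph \<Rightarrow> 'a set" where "verts \<equiv> fst"
abbreviation edges :: "'a ugraph \<Rightarrow> 'a set set" where "edges \<equiv> snd"

definition finite_graph :: "'a ugraph \<Rightarrow> bool" where
  "finite_graph G \<longleftrightarrow> finite (verts G) \<and> edges G \<subseteq> {e. e \<subseteq> verts G \<and> card e = 2}"

definition reachable :: "'a ugraph \<Rightarrow> ('a \<times> 'a) set" where
  "reachable G = {(u, v). u \<in> verts G \<and> v \<in> verts G \<and> (u, v) \<in> {(a, b). {a, b} \<in> edges G}\<^sup>*}"

definition graph_components :: "'a ugraph \<Rightarrow> 'a set set" where
  "graph_components G = verts G // reachable G"

definition is_root_set :: "'a ugraph \<Rightarrow> 'a set \<Rightarrow> bool" where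
  "is_root_set G R \<longleftrightarrow> R \<subseteq> verts G \<and> (\<forall>C\<in>graph_components G. \<exists>!r. r \<in> R \<inter> C)"

definition lipschitz_polytope :: "'a ugraph \<Rightarrow> 'a set \<Rightarrow> ('a \<Rightarrow> real) set" where
  "lipschitz_polytope G R =
     {x \<in> verts G \<rightarrow>\<^sub>E UNIV. (\<forall>r\<in>R. x r = 0) \<and>
        (\<forall>u v. {u, v} \<in> edges G \<longrightarrow> \<bar>x u - x v\<bar> \<le> 1)}"

definition polytope_volume :: "'a ugraph \<Rightarrow> 'a set \<Rightarrow> real" where
  "polytope_volume G R =
     measure (\<Pi>\<^sub>M v\<in>verts G - R. lborel)
       ((\<lambda>x. restrict x (verts G - R)) ` lipschitz_polytope G R)"

text \<open>
  The roots are fixed by Hilbert choice; the volume does not depend on them. If every component is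
  a single vertex, the defining equation reads \<open>c\<^sup>0 = 1\<close> and does not determine \<open>c\<close>; the
  value is then taken to be 1.
\<close>

definition growth_constant :: "'a ugraph \<Rightarrow> real" where
  "growth_constant G =
     (if card (verts G) = card (graph_components G) then 1
      else THE c. 0 < c \<and>
        c ^ (card (verts G) - card (graph_components G)) = polytope_volume G (SOME R. is_root_set G R))"

definition vertex_pairs :: "nat \<Rightarrow> nat set set" where
  "vertex_pairs n = {e. e \<subseteq> {1..n} \<and> card e = 2}"

definition erdos_renyi :: "nat \<Rightarrow> real \<Rightarrow> nat ugraph pmf" where
  "erdos_renyi n p =
     map_pmf (\<lambda>X. ({1..n}, {e \<in> vertex_pairs n. X e}))
       (Pi_pmf (vertex_pairs n) False (\<lambda>_. bernoulli_pmf p))"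

lemma equiv_reachable: "equiv (verts G) (reachable G)"
proof -
  let ?A = "{(a, b). {a, b} \<in> edges G}"
  have "sym ?A" by (auto simp: sym_def insert_commute)
  then have "sym (?A\<^sup>*)" by (rule sym_rtrancl)
  then have s: "sym (reachable G)"
    by (auto simp: reachable_def sym_def)
  have t: "trans (reachable G)"
    unfolding reachable_def trans_def by auto
  show ?thesis
    by (rule equivI) (use s t in \<open>auto simp: reachable_def refl_on_def\<close>)
qed

lemma ex_is_root_set: "\<exists>R. is_root_set G R"
proof -
  define f where "f C = (SOME v. v \<in> C)" for C :: "'a set"
  have f: "f C \<in> C" if "C \<in> graph_components G" for C
    using in_quotient_imp_non_empty[OF equiv_reachable] that
    unfolding graph_components_def f_def by (metis some_in_eq)
  have sub: "C \<subseteq> verts G" if "C \<in> graph_components G" for C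
    using in_quotient_imp_subset[OF equiv_reachable] that
    unfolding graph_components_def by metis
  have disj: "C = D" if "C \<in> graph_components G" "D \<in> graph_components G" "x \<in> C" "x \<in> D" for C D x
    using quotient_disj[OF equiv_reachable, of C G D] that
    unfolding graph_components_def by auto
  have "is_root_set G (f ` graph_components G)"
    unfolding is_root_set_def
  proof (intro conjI ballI)
    show "f ` graph_components G \<subseteq> verts G" using f sub by blast
    fix C assume C: "C \<in> graph_components G"
    show "\<exists>!r. r \<in> f ` graph_components G \<inter> C"
    proof (rule ex1I[of _ "f C"])
      show "f C \<in> f ` graph_components G \<inter> C" using f C by blast
      fix r assume "r \<in> f ` graph_components G \<inter> C"
      then obtain D where "D \<in> graph_components G" "r = f D" "r \<in> C" by blast
      then show "r = f C" using disj f C by metis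
    qed
  qed
  then show ?thesis ..
qed

lemma polytope_volume_ge_1:
  assumes fin: "finite_graph G" and R: "is_root_set G R"
  shows "polytope_volume G R \<ge> 1"
proof -
  let ?I = "verts G - R"
  let ?M = "\<Pi>\<^sub>M v\<in>?I. (lborel :: real measure)"
  let ?A = "{(a, b). {a, b} \<in> edges G}"
  interpret finite_product_sigma_finite "\<lambda>_. lborel :: real measure" ?I
    by standard (use fin in \<open>auto simp: finite_graph_def\<close>)
  have RV: "R \<subseteq> verts G" using R by (simp add: is_root_set_def)
  have EV: "u \<in> verts G \<and> v \<in> verts G" if "{u, v} \<in> edges G" for u v
    using that fin unfolding finite_graph_def by blast
  define ext where "ext y w = (if w \<in> R then 0 else y w)" for y :: "'a \<Rightarrow> real" and w
  define S where "S = {y \<in> space ?M. \<forall>p\<in>{(u, v). {u, v} \<in> edges G}. \<bar>ext y (fst p) - ext y (snd p)\<bar> \<le> 1}"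
  have img: "(\<lambda>x. restrict x ?I) ` lipschitz_polytope G R = S"
  proof (intro equalityI subsetI)
    fix y assume "y \<in> (\<lambda>x. restrict x ?I) ` lipschitz_polytope G R"
    then obtain x where x: "x \<in> lipschitz_polytope G R" "y = restrict x ?I" by blast
    have "ext y w = x w" if "w \<in> verts G" for w
      using x that by (auto simp: ext_def lipschitz_polytope_def)
    then show "y \<in> S" using x EV unfolding S_def
      by (auto simp: space_PiM lipschitz_polytope_def)
  next
    fix y assume y: "y \<in> S"
    define x where "x = restrict (ext y) (verts G)"
    have "\<bar>x u - x v\<bar> \<le> 1" if "{u, v} \<in> edges G" for u v
    proof -
      have "\<bar>ext y u - ext y v\<bar> \<le> 1" using y that unfolding S_def by auto
      then show ?thesis using EV[OF that] by (simp add: x_def)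
    qed
    moreover have "x r = 0" if "r \<in> R" for r
      using that RV by (auto simp: x_def ext_def)
    ultimately have "x \<in> lipschitz_polytope G R"
      unfolding lipschitz_polytope_def by (auto simp: x_def)
    moreover have "y = restrict x ?I"
      using y unfolding S_def x_def
      by (auto simp: space_PiM ext_def fun_eq_iff PiE_def extensional_def)
    ultimately show "y \<in> (\<lambda>x. restrict x ?I) ` lipschitz_polytope G R" by blast
  qed
  have finE: "finite {(u, v). {u, v} \<in> edges G}"
    by (rule finite_subset[of _ "verts G \<times> verts G"])
       (use EV fin in \<open>auto simp: finite_graph_def\<close>)
  have ext_meas: "(\<lambda>y. ext y w) \<in> borel_measurable ?M" if "w \<in> verts G" for w
    using that by (cases "w \<in> R") (auto simp: ext_def)
  have meas: "S \<in> sets ?M"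
    unfolding S_def
  proof (rule sets.sets_Collect_finite_All[OF _ finE])
    fix p assume "p \<in> {(u, v). {u, v} \<in> edges G}"
    then have m: "(\<lambda>y. ext y (fst p)) \<in> borel_measurable ?M" "(\<lambda>y. ext y (snd p)) \<in> borel_measurable ?M"
      using EV by (auto intro!: ext_meas)
    show "{y \<in> space ?M. \<bar>ext y (fst p) - ext y (snd p)\<bar> \<le> 1} \<in> sets ?M"
      using m by measurable
  qed
  have bound: "\<exists>k::nat. \<forall>y\<in>S. \<bar>y v\<bar> \<le> k" if v: "v \<in> ?I" for v
  proof -
    have "reachable G `` {v} \<in> graph_components G"
      unfolding graph_components_def using v by (auto intro: quotientI)
    then have "\<exists>!r. r \<in> R \<inter> reachable G `` {v}"
      using R[unfolded is_root_set_def, THEN conjunct2] by (rule bspec[rotated])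
    then obtain r where r: "r \<in> R" "(v, r) \<in> reachable G"
      by blast
    then have "(v, r) \<in> ?A\<^sup>*" by (simp add: reachable_def)
    then obtain k where k: "(v, r) \<in> ?A ^^ k"
      using rtrancl_imp_relpow by metis
    have *: "\<bar>ext y v - ext y w\<bar> \<le> k" if "y \<in> S" "(v, w) \<in> ?A ^^ k" for y w k
      using that(2)
    proof (induction k arbitrary: w)
      case (Suc k)
      then obtain z where z: "(v, z) \<in> ?A ^^ k" "{z, w} \<in> edges G" by auto
      have "\<bar>ext y z - ext y w\<bar> \<le> 1" using z that(1) unfolding S_def by auto
      then show ?case using Suc.IH[OF z(1)] by auto
    qed auto
    have "\<bar>y v\<bar> \<le> k" if "y \<in> S" for y
      using *[OF that k] r v by (auto simp: ext_def)
    then show ?thesis by blast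
  qed
  then obtain k :: "'a \<Rightarrow> nat" where k: "\<And>v y. v \<in> ?I \<Longrightarrow> y \<in> S \<Longrightarrow> \<bar>y v\<bar> \<le> k v"
    by metis
  have "S \<subseteq> (\<Pi>\<^sub>E v\<in>?I. {- real (k v)..real (k v)})"
  proof
    fix y assume y: "y \<in> S"
    then have "y \<in> extensional ?I" by (auto simp: S_def space_PiM PiE_def)
    moreover have "y v \<in> {- real (k v)..real (k v)}" if "v \<in> ?I" for v
      using k[OF that y] by auto
    ultimately show "y \<in> (\<Pi>\<^sub>E v\<in>?I. {- real (k v)..real (k v)})" by (auto simp: PiE_def)
  qed
  then have "emeasure ?M S \<le> emeasure ?M (\<Pi>\<^sub>E v\<in>?I. {- real (k v)..real (k v)})"
    by (intro emeasure_mono sets_PiM_I_finite finite_index) auto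
  also have "\<dots> = (\<Prod>v\<in>?I. emeasure lborel {- real (k v)..real (k v)})"
    by (rule measure_times) auto
  also have "\<dots> < \<infinity>"
    by (auto simp: less_top[symmetric] ennreal_prod_eq_top)
  finally have finS: "emeasure ?M S \<noteq> \<infinity>" by simp
  have "(\<Pi>\<^sub>E v\<in>?I. {- 1 / 2..1 / 2}) \<subseteq> S"
  proof
    fix y :: "'a \<Rightarrow> real" assume y: "y \<in> (\<Pi>\<^sub>E v\<in>?I. {- 1 / 2..1 / 2})"
    have b: "\<bar>ext y w\<bar> \<le> 1 / 2" if "w \<in> verts G" for w
    proof (cases "w \<in> R")
      case False
      then have "y w \<in> {- 1 / 2..1 / 2}" using y that by auto
      then show ?thesis using False by (auto simp: ext_def)
    qed (simp add: ext_def)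
    have "\<bar>ext y u - ext y v\<bar> \<le> 1" if "{u, v} \<in> edges G" for u v
      using b[of u] b[of v] EV[OF that] by linarith
    moreover have "y \<in> space ?M" using y by (auto simp: space_PiM PiE_def)
    ultimately show "y \<in> S" unfolding S_def by auto
  qed
  then have "emeasure ?M (\<Pi>\<^sub>E v\<in>?I. {- 1 / 2..1 / 2}) \<le> emeasure ?M S"
    by (intro emeasure_mono meas)
  moreover have "emeasure ?M (\<Pi>\<^sub>E v\<in>?I. {- 1 / 2..1 / 2}) = 1"
    by (subst measure_times) (auto simp: one_ennreal_def[symmetric])
  ultimately have "1 \<le> emeasure ?M S" by simp
  then have "1 \<le> measure ?M S"
    using finS by (metis emeasure_eq_ennreal_measure ennreal_le_iff2 ennreal_1 infinity_ennreal_def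
      not_one_le_zero)
  then show ?thesis unfolding polytope_volume_def img .
qed

text \<open>Outside the degenerate case the defining equation has exactly one
  positive solution.\<close>

lemma growth_constant:
  assumes "finite_graph G" and "card (graph_components G) < card (verts G)"
  shows "0 < growth_constant G"
    and "growth_constant G ^ (card (verts G) - card (graph_components G)) =
      polytope_volume G (SOME R. is_root_set G R)"
proof -
  define m where "m = card (verts G) - card (graph_components G)"
  define v where "v = polytope_volume G (SOME R. is_root_set G R)"
  have m: "m > 0" using assms(2) by (simp add: m_def)
  have v: "v > 0"
    using polytope_volume_ge_1[OF assms(1) someI_ex[OF ex_is_root_set]] by (simp add: v_def)
  have "\<exists>!c. 0 < c \<and> c ^ m = v"
    using m v by (rule realpow_pos_nth_unique)
  from theI'[OF this] have "0 < growth_constant G \<and> growth_constant G ^ m = v"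
    using assms(2) unfolding growth_constant_def m_def v_def by simp
  then show "0 < growth_constant G"
    and "growth_constant G ^ (card (verts G) - card (graph_components G)) =
      polytope_volume G (SOME R. is_root_set G R)"
    by (simp_all add: m_def v_def)
qed

lemma set_pmf_erdos_renyi:
  assumes "G \<in> set_pmf (erdos_renyi n p)"
  shows "finite_graph G" and "verts G = {1..n}"
proof -
  obtain X where "G = ({1..n}, {e \<in> vertex_pairs n. X e})"
    using assms unfolding erdos_renyi_def by auto
  then show "finite_graph G" and "verts G = {1..n}"
    unfolding finite_graph_def vertex_pairs_def by (simp_all only: fst_conv snd_conv) blast
qed

end

theory Submission
  imports Defs "HOL-Real_Asymp.Real_Asymp"
begin

text \<open>
  First moment method. Let \<open>p = d / n\<close> and \<open>q = 1 - p\<close>. A fixed \<open>x\<close> is Lipschitz for the random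
  graph with probability \<open>q ^ b\<close>, where \<open>b\<close> counts the pairs with \<open>\<bar>x u - x v\<bar> > 1\<close>, so for a fixed
  root set one has to integrate \<open>q ^ b\<close> over \<open>x\<close>.

  Vertices within distance 1 of the median: the window splits into two unit intervals, and after
  translating them onto each other the bad pairs are the inversions of a word in two letters, with all
  relative orders equally likely. The integral is therefore a sum of Gaussian binomial coefficients, each
  at most \<open>\<Prod>i. 1 / (1 - q ^ i) \<le> exp (\<pi>\<^sup>2 / (6 p))\<close>; this is where \<open>\<pi>\<^sup>2 / 6\<close> comes from.

  The other vertices lie in at least \<open>n / 2\<close> bad pairs each, costing \<open>exp (- d / 4)\<close> per vertex. They are
  kept at bounded volume by an edge to a parent closer to the roots, which gains at most a factor
  \<open>n * p * 2 = 2 d\<close> per vertex.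

  Finally, the number of components is at most \<open>exp (- d / 4) * n\<close> with high probability, since otherwise
  half of the components would give a large cut without edges; hence the union bound over root sets
  costs only \<open>o(n / d)\<close> in the exponent.
\<close>

section \<open>Gaussian binomial coefficients\<close>

text \<open>The Gaussian binomial coefficient \<open>[k + l choose k]\<close> at \<open>q\<close>,
  indexed by the two letter counts. The product form allows a comparison with
  \<open>1 / (1 - q ^ i)\<close> factor by factor.\<close>

definition qbinomial :: "real \<Rightarrow> nat \<Rightarrow> nat \<Rightarrow> real" where
  "qbinomial q k l = (\<Prod>i=1..k. (1 - q ^ (l + i)) / (1 - q ^ i))"

lemma qbinomial_0_left [simp]: "qbinomial q 0 l = 1"
  by (simp add: qbinomial_def)

lemma one_minus_power_pos:
  fixes q :: real
  assumes "0 < q" "q < 1" "0 < i"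
  shows "0 < 1 - q ^ i"
  using assms by (simp add: power_less_one_iff)

lemma qbinomial_0_right:
  assumes "0 < q" "q < 1"
  shows "qbinomial q k 0 = 1"
  unfolding qbinomial_def
proof (rule prod.neutral, intro ballI)
  fix i assume "i \<in> {1..k}"
  then show "(1 - q ^ (0 + i)) / (1 - q ^ i) = 1"
    using one_minus_power_pos[OF assms, of i] by simp
qed

lemma qbinomial_Suc_left:
  "qbinomial q (Suc k) l = qbinomial q k l * (1 - q ^ (l + Suc k)) / (1 - q ^ Suc k)"
  by (simp add: qbinomial_def)

text \<open>Raising \<open>l\<close> shifts all numerators of the product by one, so only the first
  and the last of them survive in the quotient. The induction on \<open>k\<close> performs this
  telescoping.\<close>

lemma qbinomial_Suc_right:
  assumes "0 < q" "q < 1"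
  shows "qbinomial q k (Suc l) * (1 - q ^ Suc l) = qbinomial q k l * (1 - q ^ (l + Suc k))"
proof (induction k)
  case (Suc k)
  have "qbinomial q (Suc k) (Suc l) * (1 - q ^ Suc l)
    = (qbinomial q k (Suc l) * (1 - q ^ Suc l)) * (1 - q ^ (Suc l + Suc k)) / (1 - q ^ Suc k)"
    by (simp add: qbinomial_Suc_left)
  also have "\<dots> = qbinomial q (Suc k) l * (1 - q ^ (l + Suc (Suc k)))"
    unfolding Suc.IH by (simp add: qbinomial_Suc_left)
  finally show ?case .
qed simp

text \<open>Multiplied by the top numerator \<open>e\<close>, both terms on the right become
  multiples of the left side \<open>M\<close>, and what remains is
  \<open>q ^ Suc l * a + b = e\<close>.\<close>

lemma qbinomial_pascal:
  assumes "0 < q" "q < 1"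
  shows "qbinomial q (Suc k) (Suc l) = q ^ Suc l * qbinomial q k (Suc l) + qbinomial q (Suc k) l"
proof -
  define a where "a = 1 - q ^ Suc k"
  define b where "b = 1 - q ^ Suc l"
  define e where "e = 1 - q ^ (Suc l + Suc k)"
  have pos: "a > 0" "b > 0" "e > 0"
    using one_minus_power_pos[OF assms] by (simp_all only: a_def b_def e_def zero_less_Suc add_Suc)
  define M where "M = qbinomial q (Suc k) (Suc l)"
  have 1: "qbinomial q k (Suc l) * e = M * a"
    using pos qbinomial_Suc_left[of q k "Suc l"] by (simp add: M_def a_def e_def)
  have 2: "qbinomial q (Suc k) l * e = M * b"
    using qbinomial_Suc_right[OF assms, of "Suc k" l] by (simp add: M_def b_def e_def)
  have "e * (q ^ Suc l * qbinomial q k (Suc l) + qbinomial q (Suc k) l) = q ^ Suc l * (M * a) + M * b"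
    by (simp only: 1[symmetric] 2[symmetric]) (simp add: algebra_simps)
  also have "\<dots> = e * M"
    by (simp add: a_def b_def e_def algebra_simps power_add)
  finally show ?thesis using pos by (simp add: M_def)
qed

lemma qbinomial_nonneg:
  assumes "0 < q" "q < 1"
  shows "0 \<le> qbinomial q k l"
  unfolding qbinomial_def
proof (rule prod_nonneg, rule divide_nonneg_nonneg)
  fix i assume "i \<in> {1..k}"
  then show "0 \<le> 1 - q ^ (l + i)" "0 \<le> 1 - q ^ i"
    using one_minus_power_pos[OF assms, of i] one_minus_power_pos[OF assms, of "l + i"] by auto
qed

text \<open>The geometric series with ratio \<open>r = q ^ m\<close> is at most
  \<open>r / (1 - r)\<close>. Moreover
  \<open>m * r \<le> 1 + q + ... + q ^ (m - 1) = (1 - r) / (1 - q)\<close>, as each of these powers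
  is at least \<open>r\<close>.\<close>

lemma geometric_sum_bound:
  assumes "0 < q" "q < 1" "0 < m"
  shows "(\<Sum>i=1..k. (q ^ i) ^ m) \<le> 1 / (real m * (1 - q))"
proof -
  define r where "r = q ^ m"
  have r: "0 < r" "r < 1" using assms by (simp_all add: r_def power_less_one_iff)
  have "(\<Sum>i=1..k. (q ^ i) ^ m) = (\<Sum>i=1..k. r ^ i)"
    by (simp add: r_def mult.commute flip: power_mult)
  also have "\<dots> * (1 - r) = r - r ^ Suc k"
  proof (induction k)
    case (Suc k)
    have "(\<Sum>i=1..Suc k. r ^ i) * (1 - r) = (\<Sum>i=1..k. r ^ i) * (1 - r) + r ^ Suc k * (1 - r)"
      by (simp add: distrib_right)
    also have "\<dots> = r - r ^ Suc (Suc k)"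
      unfolding Suc.IH by (simp add: algebra_simps)
    finally show ?case .
  qed simp
  then have "(\<Sum>i=1..k. r ^ i) = (r - r ^ Suc k) / (1 - r)"
    using r by (simp add: field_simps)
  also have "\<dots> \<le> r / (1 - r)"
    using r by (intro divide_right_mono) auto
  also have "\<dots> \<le> 1 / (real m * (1 - q))"
  proof -
    have "real m * r = (\<Sum>i<m. r)" by simp
    also have "\<dots> \<le> (\<Sum>i<m. q ^ i)"
      unfolding r_def using assms by (intro sum_mono power_decreasing) auto
    finally have "(1 - q) * (real m * r) \<le> (1 - q) * (\<Sum>i<m. q ^ i)"
      using assms by (intro mult_left_mono) auto
    also have "\<dots> = 1 - r" by (simp add: r_def one_diff_power_eq)
    finally show ?thesis using r assms by (simp add: field_simps)
  qed
  finally show ?thesis .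
qed

text \<open>Drop the numerators, expand each \<open>- ln (1 - q ^ i)\<close> into its power series
  and sum over \<open>i\<close> first. The terms of degree \<open>m\<close> then contribute at most
  \<open>1 / (1 - q)\<close> times \<open>1 / m\<^sup>2\<close>, and Euler's series gives a bound
  uniform in \<open>k\<close> and \<open>l\<close>.\<close>

lemma qbinomial_le:
  assumes "0 < q" "q < 1"
  shows "qbinomial q k l \<le> exp (pi\<^sup>2 / (6 * (1 - q)))"
proof -
  have pos: "0 < q ^ i" "q ^ i < 1" if "i \<in> {1..k}" for i
    using assms that by (auto simp: power_less_one_iff)
  have lnsum: "(\<lambda>m. (q ^ i) ^ Suc m / real (Suc m)) sums (- ln (1 - q ^ i))" if "i \<in> {1..k}" for i
  proof -
    have "(\<lambda>m. - ((q ^ i) ^ m / real m)) sums ln (1 - q ^ i)"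
      using ln_series'[of "- (q ^ i)"] pos[OF that] by simp
    then have "(\<lambda>m. (q ^ i) ^ m / real m) sums (- ln (1 - q ^ i))"
      using sums_minus[of "\<lambda>m. - ((q ^ i) ^ m / real m)"] by simp
    \<comment> \<open>The term at index 0 is a division by zero, hence 0, so the shift to
      \<open>Suc m\<close> does not change the sum.\<close>
    then show ?thesis
      using sums_Suc_iff[of "\<lambda>m. (q ^ i) ^ m / real m"] by simp
  qed
  have lhs: "(\<lambda>m. \<Sum>i=1..k. (q ^ i) ^ Suc m / real (Suc m)) sums (\<Sum>i=1..k. - ln (1 - q ^ i))"
    using lnsum by (intro sums_sum)
  have rhs: "(\<lambda>m. 1 / (1 - q) * (1 / (real m + 1)\<^sup>2)) sums (1 / (1 - q) * (pi\<^sup>2 / 6))"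
    using inverse_squares_sums by (intro sums_mult) (simp add: add.commute)
  have term_le: "(\<Sum>i=1..k. (q ^ i) ^ Suc m / real (Suc m)) \<le> 1 / (1 - q) * (1 / (real m + 1)\<^sup>2)" for m
  proof -
    have "(\<Sum>i=1..k. (q ^ i) ^ Suc m / real (Suc m)) = (\<Sum>i=1..k. (q ^ i) ^ Suc m) / real (Suc m)"
      by (simp only: sum_divide_distrib)
    also have "\<dots> \<le> 1 / (real (Suc m) * (1 - q)) / real (Suc m)"
      using geometric_sum_bound[OF assms, of "Suc m" k] by (intro divide_right_mono) auto
    also have "\<dots> = 1 / (1 - q) * (1 / (real m + 1)\<^sup>2)"
      by (simp add: power2_eq_square ac_simps)
    finally show ?thesis .
  qed
  from sums_le[OF term_le lhs rhs] have le: "(\<Sum>i=1..k. - ln (1 - q ^ i)) \<le> 1 / (1 - q) * (pi\<^sup>2 / 6)"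
    .
  have "qbinomial q k l \<le> (\<Prod>i=1..k. 1 / (1 - q ^ i))"
    unfolding qbinomial_def
  proof (rule prod_mono, intro conjI)
    fix i assume i: "i \<in> {1..k}"
    have "0 < 1 - q ^ (l + i)" by (rule one_minus_power_pos[OF assms]) (use i in auto)
    then show "0 \<le> (1 - q ^ (l + i)) / (1 - q ^ i)" 
      using pos[OF i] by auto
    show "(1 - q ^ (l + i)) / (1 - q ^ i) \<le> 1 / (1 - q ^ i)"
      using pos[OF i] assms by (intro divide_right_mono) auto
  qed
  also have "\<dots> = exp (\<Sum>i=1..k. - ln (1 - q ^ i))"
    unfolding exp_sum[OF finite_atLeastAtMost]
    using pos by (intro prod.cong) (auto simp: exp_minus inverse_eq_divide)
  also have "\<dots> \<le> exp (pi\<^sup>2 / (6 * (1 - q)))"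
    using le by (simp add: mult.commute)
  finally show ?thesis .
qed

section \<open>The window integral\<close>

text \<open>\<open>K\<close> and \<open>U\<close> are the two kinds of letters, and the offset
  \<open>x v - \<beta> v\<close> is the position of \<open>v\<close> after translation. In the
  application the base points of \<open>K\<close> lie one interval length above those of
  \<open>U\<close>, so an inversion is a pair farther apart than that length.\<close>

definition separation_weight ::
  "real \<Rightarrow> ('a \<Rightarrow> real) \<Rightarrow> 'a set \<Rightarrow> 'a set \<Rightarrow> real \<Rightarrow> ('a \<Rightarrow> real) \<Rightarrow> real" where
  "separation_weight q \<beta> K U s x =
     (if \<forall>v\<in>K \<union> U. \<beta> v \<le> x v \<and> x v \<le> \<beta> v + s
      then \<Prod>u\<in>U. \<Prod>v\<in>K. if x u - \<beta> u < x v - \<beta> v then q else 1 else 0)"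

lemma separation_weight_nonneg: "0 < q \<Longrightarrow> 0 \<le> separation_weight q \<beta> K U s x"
  by (auto simp: separation_weight_def intro!: prod_nonneg)

lemma separation_weight_cong:
  assumes "\<And>v. v \<in> K \<union> U \<Longrightarrow> x v = y v"
  shows "separation_weight q \<beta> K U s x = separation_weight q \<beta> K U s y"
proof -
  have "(\<Prod>u\<in>U. \<Prod>v\<in>K. if x u - \<beta> u < x v - \<beta> v then q else 1)
      = (\<Prod>u\<in>U. \<Prod>v\<in>K. if y u - \<beta> u < y v - \<beta> v then q else 1)"
    by (intro prod.cong refl) (simp add: assms)
  then show ?thesis using assms by (auto simp: separation_weight_def)
qed

text \<open>The length may vary with the point because conditioning on the top vertex
  \<open>w\<close> replaces it by the offset of \<open>w\<close>.\<close>

lemma measurable_separation_weight [measurable]: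
  assumes "finite K" "finite U" "K \<union> U \<subseteq> I" and [measurable]: "s \<in> borel_measurable (Pi\<^sub>M I (\<lambda>_. lborel :: real measure))"
  shows "(\<lambda>x. separation_weight q \<beta> K U (s x) x) \<in> borel_measurable (Pi\<^sub>M I (\<lambda>_. lborel :: real measure))"
proof -
  define M where "M = Pi\<^sub>M I (\<lambda>_. lborel :: real measure)"
  have fin: "finite (K \<union> U)" using assms by simp
  have sm [measurable]: "s \<in> borel_measurable M" using assms by (simp add: M_def)
  have comp: "(\<lambda>x. x v) \<in> borel_measurable M" if "v \<in> K \<union> U" for v
    using measurable_component_singleton[of v I "\<lambda>_. lborel :: real measure"] that assms(3)
    by (auto simp: M_def)
  have "{x \<in> space M. \<forall>v\<in>K \<union> U. \<beta> v \<le> x v \<and> x v \<le> \<beta> v + s x} \<in> sets M"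
  proof (intro sets.sets_Collect_finite_All fin)
    fix v assume "v \<in> K \<union> U"
    then show "{x \<in> space M. \<beta> v \<le> x v \<and> x v \<le> \<beta> v + s x} \<in> sets M"
      by (intro sets.sets_Collect_conj borel_measurable_le borel_measurable_const borel_measurable_add comp sm)
  qed
  moreover have "(\<lambda>x. \<Prod>u\<in>U. \<Prod>v\<in>K. if x u - \<beta> u < x v - \<beta> v then q else 1) \<in> borel_measurable M"
  proof (intro borel_measurable_prod)
    fix u v assume "u \<in> U" "v \<in> K"
    then have [measurable]: "(\<lambda>x. x u) \<in> borel_measurable M" "(\<lambda>x. x v) \<in> borel_measurable M"
      using comp by auto
    show "(\<lambda>x. if x u - \<beta> u < x v - \<beta> v then q else 1) \<in> borel_measurable M"
      by measurable
  qed
  ultimately show ?thesis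
    unfolding separation_weight_def M_def[symmetric] by (intro measurable_If) auto
qed

text \<open>Condition on the vertex \<open>w\<close> whose offset \<open>x w - \<beta> w\<close> is largest; ties are resolved
  in favour of \<open>U\<close>, so that a maximiser in \<open>K\<close> is strictly above all of \<open>U\<close>.\<close>

lemma separation_weight_le_sum_max:
  assumes q: "0 < q" and fin: "finite K" "finite U" and disj: "K \<inter> U = {}" and ne: "K \<union> U \<noteq> {}"
  shows "separation_weight q \<beta> K U s x \<le>
    (\<Sum>w\<in>U. indicator {\<beta> w..\<beta> w + s} (x w) * separation_weight q \<beta> K (U - {w}) (x w - \<beta> w) x) +
    (\<Sum>w\<in>K. indicator {\<beta> w..\<beta> w + s} (x w) *
      (q ^ card U * separation_weight q \<beta> (K - {w}) U (x w - \<beta> w) x))"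
    (is "_ \<le> sum ?f U + sum ?g K")
proof (cases "\<forall>v\<in>K \<union> U. \<beta> v \<le> x v \<and> x v \<le> \<beta> v + s")
  case False
  then have "separation_weight q \<beta> K U s x = 0" unfolding separation_weight_def by (rule if_not_P)
  then show ?thesis
    using q by (auto intro!: add_nonneg_nonneg sum_nonneg mult_nonneg_nonneg separation_weight_nonneg)
next
  case True
  have f0: "0 \<le> ?f w" and g0: "0 \<le> ?g w" for w
    using q by (auto intro!: mult_nonneg_nonneg separation_weight_nonneg)
  have sf0: "0 \<le> sum ?f U" and sg0: "0 \<le> sum ?g K"
    using f0 g0 by (auto intro!: sum_nonneg)
  define off where "off v = x v - \<beta> v" for v
  define m where "m = Max (off ` (K \<union> U))"
  have m: "off v \<le> m" if "v \<in> K \<union> U" for v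
    unfolding m_def using fin that by (intro Max_ge) auto
  have "m \<in> off ` (K \<union> U)" unfolding m_def using fin ne by (intro Max_in) auto
  then obtain w where w: "w \<in> K \<union> U" "off w = m" by auto
  let ?P = "\<lambda>U K. \<Prod>u\<in>U. \<Prod>v\<in>K. if x u - \<beta> u < x v - \<beta> v then q else 1"
  have sw: "separation_weight q \<beta> K U s x = ?P U K"
    using True by (simp add: separation_weight_def)
  show ?thesis
  proof (cases "\<exists>u\<in>U. off u = m")
    case True
    then obtain u where u: "u \<in> U" "off u = m" by auto
    \<comment> \<open>A top vertex in \<open>U\<close> takes part in no inversion and can be removed
      for free.\<close>
    have "?P U K = (\<Prod>v\<in>K. if x u - \<beta> u < x v - \<beta> v then q else 1) * ?P (U - {u}) K"
      using u fin by (simp add: prod.remove)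
    also have "(\<Prod>v\<in>K. if x u - \<beta> u < x v - \<beta> v then q else 1) = 1"
    proof (intro prod.neutral ballI)
      fix v assume "v \<in> K"
      then have "off v \<le> off u" using m u by simp
      then show "(if x u - \<beta> u < x v - \<beta> v then q else 1) = 1" by (simp add: off_def)
    qed
    finally have "?P U K = ?f u"
      using m u \<open>\<forall>v\<in>K \<union> U. _\<close> by (fastforce simp: separation_weight_def off_def)
    also have "\<dots> \<le> sum ?f U" using u fin f0 by (intro member_le_sum) auto
    finally show ?thesis using sw sg0 by linarith
  next
    case False
    then have wK: "w \<in> K" using w by auto
    have lt: "off u < m" if "u \<in> U" for u
      using m[of u] False that by force
    \<comment> \<open>A top vertex in \<open>K\<close> is inverted with every vertex of
      \<open>U\<close>, which gives the factor \<open>q ^ card U\<close>.\<close>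
    have "?P U K = (\<Prod>u\<in>U. (if x u - \<beta> u < x w - \<beta> w then q else 1) *
        (\<Prod>v\<in>K - {w}. if x u - \<beta> u < x v - \<beta> v then q else 1))"
      using wK fin by (intro prod.cong refl) (simp add: prod.remove)
    also have "\<dots> = q ^ card U * ?P U (K - {w})"
      using lt w by (simp add: prod.distrib off_def)
    also have "\<dots> = ?g w"
      using m w wK \<open>\<forall>v\<in>K \<union> U. _\<close> by (fastforce simp: separation_weight_def off_def)
    also have "\<dots> \<le> sum ?g K" using wK fin g0 by (intro member_le_sum) auto
    finally show ?thesis using sw sf0 by linarith
  qed
qed

text \<open>The expectation of \<open>q\<close> to the number of inversions of a uniformly random word with
  \<open>k\<close> letters of one kind and \<open>l\<close> of another.\<close>

definition mean_weight :: "real \<Rightarrow> nat \<Rightarrow> nat \<Rightarrow> real" where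
  "mean_weight q k l = qbinomial q k l / real ((k + l) choose k)"

lemma mean_weight_nonneg: "0 < q \<Longrightarrow> q < 1 \<Longrightarrow> 0 \<le> mean_weight q k l"
  by (simp add: mean_weight_def qbinomial_nonneg)

text \<open>The Pascal rule for \<open>qbinomial\<close> divided by the ordinary binomial
  coefficient. In probabilistic terms, the top letter is of the second kind with probability
  \<open>l / (k + l)\<close>, and otherwise it is inverted with all \<open>l\<close> letters of that
  kind.\<close>

lemma mean_weight_rec:
  assumes q: "0 < q" "q < 1" and "0 < k + l"
  shows "real l * mean_weight q k (l - 1) + real k * q ^ l * mean_weight q (k - 1) l
    = real (k + l) * mean_weight q k l"
proof (cases "k = 0 \<or> l = 0")
  case True
  then show ?thesis by (auto simp: mean_weight_def qbinomial_0_right[OF q])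
next
  case False
  then obtain k' l' where kl: "k = Suc k'" "l = Suc l'" by (metis not0_implies_Suc)
  define b where "b = real ((k + l) choose k)"
  have b: "b > 0" by (simp add: b_def)
  have "k * ((k + l) choose k) = (k + l) * ((k' + l) choose k')"
    using Suc_times_binomial[of k' "k' + l"] by (simp add: kl)
  then have 1: "real k * b = real (k + l) * real ((k' + l) choose k')"
    unfolding b_def by (metis of_nat_mult)
  have "l * ((k + l) choose l) = (k + l) * ((k + l') choose l')"
    using Suc_times_binomial[of l' "k + l'"] by (simp add: kl)
  moreover have "(k + l) choose l = (k + l) choose k" "(k + l') choose l' = (k + l') choose k"
    using binomial_symmetric[of k "k + l"] binomial_symmetric[of k "k + l'"] by simp_all
  ultimately have 2: "real l * b = real (k + l) * real ((k + l') choose k)"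
    unfolding b_def by (metis of_nat_mult)
  have pos: "real ((k' + l) choose k') > 0" "real ((k + l') choose k) > 0" by simp_all
  have "real k / real ((k' + l) choose k') = real (k + l) / b"
    using 1 b pos by (simp add: field_simps)
  moreover have "real l / real ((k + l') choose k) = real (k + l) / b"
    using 2 b pos by (simp add: field_simps)
  ultimately have "real l * mean_weight q k l' + real k * q ^ l * mean_weight q k' l
      = real (k + l) / b * (q ^ l * qbinomial q k' l + qbinomial q k l')"
    unfolding mean_weight_def by (simp add: distrib_left mult.commute mult.left_commute flip: times_divide_eq_left)
  also have "\<dots> = real (k + l) * mean_weight q k l"
    unfolding mean_weight_def b_def kl qbinomial_pascal[OF q] by simp
  finally show ?thesis by (simp add: kl)
qed

lemma nn_integral_power_Icc:
  assumes "0 \<le> s"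
  shows "(\<integral>\<^sup>+y. ennreal ((y - b) ^ j) * indicator {b..b + s} y \<partial>lborel) = ennreal (s ^ Suc j / real (Suc j))"
proof -
  have "(\<integral>\<^sup>+y. ennreal ((y - b) ^ j) * indicator {b..b + s} y \<partial>lborel)
      = ennreal ((b + s - b) ^ Suc j / real (Suc j) - (b - b) ^ Suc j / real (Suc j))"
  proof (rule nn_integral_FTC_Icc[where F = "\<lambda>y. (y - b) ^ Suc j / real (Suc j)"])
    fix x assume x: "x \<in> {b..b + s}"
    show "((\<lambda>y. (y - b) ^ Suc j / real (Suc j)) has_real_derivative (x - b) ^ j) (at x)"
      by (rule derivative_eq_intros refl | simp)+
    show "0 \<le> (x - b) ^ j" using x by simp
  qed (use assms in auto)
  then show ?thesis by simp
qed

text \<open>Independent uniform offsets appear in uniformly random order, so up to the volume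
  \<open>s ^ (k + l)\<close> this is the mean weight of a random word. The induction integrates over
  the top offset: the remaining \<open>j\<close> vertices contribute its \<open>j\<close>-th power,
  the outer integral turns this into \<open>s ^ Suc j / Suc j\<close>, and
  \<open>mean_weight_rec\<close> cancels the denominator.\<close>

lemma nn_integral_separation_weight_le:
  assumes q: "0 < q" "q < 1" and "finite K" "finite U" "K \<inter> U = {}" "0 \<le> s"
  shows "(\<integral>\<^sup>+x. ennreal (separation_weight q \<beta> K U s x) \<partial>Pi\<^sub>M (K \<union> U) (\<lambda>_. lborel))
    \<le> ennreal (s ^ (card K + card U) * mean_weight q (card K) (card U))"
  using assms(3-)
proof (induction "card K + card U" arbitrary: K U s)
  case 0
  then have "K = {}" "U = {}" by auto
  then show ?case
    by (simp add: PiM_empty separation_weight_def mean_weight_def)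
next
  case (Suc j)
  interpret product_sigma_finite "\<lambda>_ :: 'a. lborel :: real measure" by standard
  let ?k = "card K" and ?l = "card U"
  \<comment> \<open>The contribution of one top vertex \<open>w\<close>, for both kinds at once:
    \<open>c\<close> is 1 when \<open>w\<close> lies in \<open>U\<close> and \<open>q ^ ?l\<close>
    when it lies in \<open>K\<close>.\<close>
  have step: "(\<integral>\<^sup>+x. ennreal (indicator {\<beta> w..\<beta> w + s} (x w) *
        (c * separation_weight q \<beta> K' U' (x w - \<beta> w) x)) \<partial>Pi\<^sub>M (K \<union> U) (\<lambda>_. lborel))
      \<le> ennreal (c * mean_weight q (card K') (card U') * (s ^ Suc j / real (Suc j)))"
    if KU: "K \<union> U = insert w (K' \<union> U')" "w \<notin> K' \<union> U'" "finite K'" "finite U'" "K' \<inter> U' = {}"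
      "j = card K' + card U'" and c: "0 \<le> c" for w K' U' c
  proof -
    have [measurable]: "(\<lambda>x. x w) \<in> borel_measurable (Pi\<^sub>M (insert w (K' \<union> U')) (\<lambda>_. lborel :: real measure))"
      using measurable_component_singleton[of w "insert w (K' \<union> U')" "\<lambda>_. lborel :: real measure"] by simp
    have [measurable]: "(\<lambda>x. separation_weight q \<beta> K' U' (x w - \<beta> w) x)
        \<in> borel_measurable (Pi\<^sub>M (insert w (K' \<union> U')) (\<lambda>_. lborel :: real measure))"
      by (intro measurable_separation_weight) (use KU in auto)
    have "(\<integral>\<^sup>+x. ennreal (indicator {\<beta> w..\<beta> w + s} (x w) *
          (c * separation_weight q \<beta> K' U' (x w - \<beta> w) x)) \<partial>Pi\<^sub>M (K \<union> U) (\<lambda>_. lborel))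
        = (\<integral>\<^sup>+y. \<integral>\<^sup>+x. ennreal (indicator {\<beta> w..\<beta> w + s} ((x(w := y)) w) *
          (c * separation_weight q \<beta> K' U' ((x(w := y)) w - \<beta> w) (x(w := y)))) \<partial>Pi\<^sub>M (K' \<union> U') (\<lambda>_. lborel) \<partial>lborel)"
      unfolding KU(1)
      by (rule product_nn_integral_insert_rev) (use KU in \<open>auto\<close>)
    also have "\<dots> = (\<integral>\<^sup>+y. \<integral>\<^sup>+x. ennreal (indicator {\<beta> w..\<beta> w + s} y * c) *
          ennreal (separation_weight q \<beta> K' U' (y - \<beta> w) x) \<partial>Pi\<^sub>M (K' \<union> U') (\<lambda>_. lborel) \<partial>lborel)"
    proof (intro nn_integral_cong)
      fix y x
      have "separation_weight q \<beta> K' U' (y - \<beta> w) (x(w := y)) = separation_weight q \<beta> K' U' (y - \<beta> w) x"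
        using KU(2) by (intro separation_weight_cong) auto
      then show "ennreal (indicator {\<beta> w..\<beta> w + s} ((x(w := y)) w) *
          (c * separation_weight q \<beta> K' U' ((x(w := y)) w - \<beta> w) (x(w := y))))
        = ennreal (indicator {\<beta> w..\<beta> w + s} y * c) * ennreal (separation_weight q \<beta> K' U' (y - \<beta> w) x)"
        using c separation_weight_nonneg[OF q(1), of \<beta> K' U' "y - \<beta> w" x]
        by (cases "y \<in> {\<beta> w..\<beta> w + s}") (simp_all add: ennreal_mult)
    qed
    also have "\<dots> = (\<integral>\<^sup>+y. ennreal (indicator {\<beta> w..\<beta> w + s} y * c) *
          (\<integral>\<^sup>+x. ennreal (separation_weight q \<beta> K' U' (y - \<beta> w) x) \<partial>Pi\<^sub>M (K' \<union> U') (\<lambda>_. lborel)) \<partial>lborel)"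
    proof (intro nn_integral_cong nn_integral_cmult)
      fix y
      have "(\<lambda>x. separation_weight q \<beta> K' U' (y - \<beta> w) x)
        \<in> borel_measurable (Pi\<^sub>M (K' \<union> U') (\<lambda>_. lborel :: real measure))"
        by (intro measurable_separation_weight) (use KU in auto)
      then show "(\<lambda>x. ennreal (separation_weight q \<beta> K' U' (y - \<beta> w) x))
        \<in> borel_measurable (Pi\<^sub>M (K' \<union> U') (\<lambda>_. lborel :: real measure))" by measurable
    qed
    also have "\<dots> \<le> (\<integral>\<^sup>+y. ennreal (c * mean_weight q (card K') (card U')) *
        (ennreal ((y - \<beta> w) ^ j) * indicator {\<beta> w..\<beta> w + s} y) \<partial>lborel)"
    proof (intro nn_integral_mono)
      fix y
      show "ennreal (indicator {\<beta> w..\<beta> w + s} y * c) *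
          (\<integral>\<^sup>+x. ennreal (separation_weight q \<beta> K' U' (y - \<beta> w) x) \<partial>Pi\<^sub>M (K' \<union> U') (\<lambda>_. lborel))
        \<le> ennreal (c * mean_weight q (card K') (card U')) *
        (ennreal ((y - \<beta> w) ^ j) * indicator {\<beta> w..\<beta> w + s} y)"
      proof (cases "y \<in> {\<beta> w..\<beta> w + s}")
        case True
        then have "(\<integral>\<^sup>+x. ennreal (separation_weight q \<beta> K' U' (y - \<beta> w) x) \<partial>Pi\<^sub>M (K' \<union> U') (\<lambda>_. lborel))
          \<le> ennreal ((y - \<beta> w) ^ j * mean_weight q (card K') (card U'))"
          using Suc.hyps(1)[of K' U' "y - \<beta> w"] KU by simp
        then have "ennreal c * (\<integral>\<^sup>+x. ennreal (separation_weight q \<beta> K' U' (y - \<beta> w) x) \<partial>Pi\<^sub>M (K' \<union> U') (\<lambda>_. lborel))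
          \<le> ennreal c * ennreal ((y - \<beta> w) ^ j * mean_weight q (card K') (card U'))"
          by (rule mult_left_mono) simp
        also have "\<dots> = ennreal (c * mean_weight q (card K') (card U')) * ennreal ((y - \<beta> w) ^ j)"
          using c True mean_weight_nonneg[OF q] by (simp add: ac_simps flip: ennreal_mult)
        finally show ?thesis using True by simp
      qed simp
    qed
    also have "\<dots> = ennreal (c * mean_weight q (card K') (card U')) * ennreal (s ^ Suc j / real (Suc j))"
      by (subst nn_integral_cmult) (simp_all add: nn_integral_power_Icc[OF \<open>0 \<le> s\<close>] del: power_Suc of_nat_Suc)
    also have "\<dots> = ennreal (c * mean_weight q (card K') (card U') * (s ^ Suc j / real (Suc j)))"
      using c mean_weight_nonneg[OF q] \<open>0 \<le> s\<close> by (intro ennreal_mult[symmetric]) auto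
    finally show ?thesis .
  qed
  have ne: "K \<union> U \<noteq> {}" using Suc.hyps(2) by auto
  let ?f = "\<lambda>w x. indicator {\<beta> w..\<beta> w + s} (x w) * (1 * separation_weight q \<beta> K (U - {w}) (x w - \<beta> w) x)"
  let ?g = "\<lambda>w x. indicator {\<beta> w..\<beta> w + s} (x w) * (q ^ ?l * separation_weight q \<beta> (K - {w}) U (x w - \<beta> w) x)"
  let ?M = "Pi\<^sub>M (K \<union> U) (\<lambda>_. lborel :: real measure)"
  have f0: "0 \<le> ?f w x" and g0: "0 \<le> ?g w x" for w x
    using q by (auto intro!: mult_nonneg_nonneg separation_weight_nonneg)
  have comp: "(\<lambda>x. x w) \<in> borel_measurable ?M" if "w \<in> K \<union> U" for w
    using measurable_component_singleton[of w "K \<union> U" "\<lambda>_. lborel :: real measure"] that by simp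
  have fm: "?f w \<in> borel_measurable ?M" if "w \<in> U" for w
  proof -
    note [measurable] = comp[of w]
    have [measurable]: "w \<in> K \<union> U" using that by simp
    have [measurable]: "(\<lambda>x. separation_weight q \<beta> K (U - {w}) (x w - \<beta> w) x) \<in> borel_measurable ?M"
      by (intro measurable_separation_weight) (use Suc.prems in auto)
    show ?thesis by measurable
  qed
  have gm: "?g w \<in> borel_measurable ?M" if "w \<in> K" for w
  proof -
    note [measurable] = comp[of w]
    have [measurable]: "w \<in> K \<union> U" using that by simp
    have [measurable]: "(\<lambda>x. separation_weight q \<beta> (K - {w}) U (x w - \<beta> w) x) \<in> borel_measurable ?M"
      by (intro measurable_separation_weight) (use Suc.prems in auto)
    show ?thesis by measurable
  qed
  have "(\<integral>\<^sup>+x. ennreal (separation_weight q \<beta> K U s x) \<partial>?M)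
      \<le> (\<integral>\<^sup>+x. (\<Sum>w\<in>U. ennreal (?f w x)) + (\<Sum>w\<in>K. ennreal (?g w x)) \<partial>?M)"
  proof (rule nn_integral_mono)
    fix x
    have "separation_weight q \<beta> K U s x \<le> (\<Sum>w\<in>U. ?f w x) + (\<Sum>w\<in>K. ?g w x)"
      using separation_weight_le_sum_max[OF q(1) Suc.prems(1,2,3) ne, of \<beta> s x] by simp
    then have "ennreal (separation_weight q \<beta> K U s x) \<le> ennreal ((\<Sum>w\<in>U. ?f w x) + (\<Sum>w\<in>K. ?g w x))"
      by (rule ennreal_leI)
    also have "\<dots> = (\<Sum>w\<in>U. ennreal (?f w x)) + (\<Sum>w\<in>K. ennreal (?g w x))"
      using f0 g0 by (subst ennreal_plus) (auto intro!: sum_nonneg simp: sum_ennreal)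
    finally show "ennreal (separation_weight q \<beta> K U s x) \<le> (\<Sum>w\<in>U. ennreal (?f w x)) + (\<Sum>w\<in>K. ennreal (?g w x))" .
  qed
  also have "\<dots> = (\<Sum>w\<in>U. \<integral>\<^sup>+x. ennreal (?f w x) \<partial>?M) + (\<Sum>w\<in>K. \<integral>\<^sup>+x. ennreal (?g w x) \<partial>?M)"
    using fm gm by (subst nn_integral_add) (auto simp: nn_integral_sum simp del: mult_1)
  also have "\<dots> \<le> (\<Sum>w\<in>U. ennreal (1 * mean_weight q ?k (?l - 1) * (s ^ Suc j / real (Suc j)))) +
      (\<Sum>w\<in>K. ennreal (q ^ ?l * mean_weight q (?k - 1) ?l * (s ^ Suc j / real (Suc j))))"
  proof (intro add_mono sum_mono)
    fix w assume w: "w \<in> U"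
    have c: "card (U - {w}) = ?l - 1" "?l > 0" using w Suc.prems by (auto simp: card_gt_0_iff)
    show "(\<integral>\<^sup>+x. ennreal (?f w x) \<partial>?M) \<le> ennreal (1 * mean_weight q ?k (?l - 1) * (s ^ Suc j / real (Suc j)))"
      unfolding c(1)[symmetric] by (rule step) (use w Suc.prems Suc.hyps(2) c in auto)
  next
    fix w assume w: "w \<in> K"
    have c: "card (K - {w}) = ?k - 1" "?k > 0" using w Suc.prems by (auto simp: card_gt_0_iff)
    show "(\<integral>\<^sup>+x. ennreal (?g w x) \<partial>?M) \<le> ennreal (q ^ ?l * mean_weight q (?k - 1) ?l * (s ^ Suc j / real (Suc j)))"
      unfolding c(1)[symmetric] by (rule step) (use w Suc.prems Suc.hyps(2) c q in auto)
  qed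
  also have "\<dots> = ennreal (\<Sum>w\<in>U. 1 * mean_weight q ?k (?l - 1) * (s ^ Suc j / real (Suc j))) +
      ennreal (\<Sum>w\<in>K. q ^ ?l * mean_weight q (?k - 1) ?l * (s ^ Suc j / real (Suc j)))"
    using mean_weight_nonneg[OF q] q \<open>0 \<le> s\<close> by (subst (1 2) sum_ennreal) auto
  also have "\<dots> = ennreal ((\<Sum>w\<in>U. 1 * mean_weight q ?k (?l - 1) * (s ^ Suc j / real (Suc j))) +
      (\<Sum>w\<in>K. q ^ ?l * mean_weight q (?k - 1) ?l * (s ^ Suc j / real (Suc j))))"
    using mean_weight_nonneg[OF q] q \<open>0 \<le> s\<close> by (intro ennreal_plus[symmetric] sum_nonneg) auto
  also have "\<dots> = ennreal ((real ?l * mean_weight q ?k (?l - 1) + real ?k * q ^ ?l * mean_weight q (?k - 1) ?l)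
      * (s ^ Suc j / real (Suc j)))"
    by (simp only: sum_constant distrib_right mult.assoc mult_1)
  also have "\<dots> = ennreal (s ^ (?k + ?l) * mean_weight q ?k ?l)"
    using mean_weight_rec[OF q, of ?k ?l] Suc.hyps(2)[symmetric] by (simp add: mult.commute del: power_Suc of_nat_Suc)
  finally show ?case .
qed

section \<open>Integrating out vertices along parent maps\<close>

text \<open>Integrals run over the coordinates outside the root set; this puts the roots back at
  height 0.\<close>

definition zero_on :: "'a set \<Rightarrow> ('a \<Rightarrow> real) \<Rightarrow> 'a \<Rightarrow> real" where
  "zero_on R y v = (if v \<in> R then 0 else y v)"

lemma zero_on_upd: "l \<notin> R \<Longrightarrow> zero_on R (y(l := a)) v = (if v = l then a else zero_on R y v)"
  by (simp add: zero_on_def)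

lemma measurable_zero_on:
  assumes "v \<in> I \<union> R"
  shows "(\<lambda>y. zero_on R y v) \<in> borel_measurable (Pi\<^sub>M I (\<lambda>_. lborel :: real measure))"
proof (cases "v \<in> R")
  case False
  then show ?thesis
    using measurable_component_singleton[of v I "\<lambda>_. lborel :: real measure"] assms
    by (simp add: zero_on_def)
qed (simp add: zero_on_def)

lemma measurable_zero_on_Lipschitz:
  assumes fin: "finite P" and P: "\<And>u v. (u, v) \<in> P \<Longrightarrow> u \<in> I \<union> R \<and> v \<in> I \<union> R"
  shows "{y \<in> space (Pi\<^sub>M I (\<lambda>_. lborel :: real measure)).
      \<forall>e\<in>P. \<bar>zero_on R y (fst e) - zero_on R y (snd e)\<bar> \<le> 1} \<in> sets (Pi\<^sub>M I (\<lambda>_. lborel))"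
proof (rule sets.sets_Collect_finite_All[OF _ fin])
  fix e assume "e \<in> P"
  then have "fst e \<in> I \<union> R" "snd e \<in> I \<union> R" using P[of "fst e" "snd e"] by auto
  then have "(\<lambda>y. \<bar>zero_on R y (fst e) - zero_on R y (snd e)\<bar>)
      \<in> borel_measurable (Pi\<^sub>M I (\<lambda>_. lborel :: real measure))"
    by (intro borel_measurable_abs borel_measurable_diff measurable_zero_on)
  then show "{y \<in> space (Pi\<^sub>M I (\<lambda>_. lborel :: real measure)).
      \<bar>zero_on R y (fst e) - zero_on R y (snd e)\<bar> \<le> 1} \<in> sets (Pi\<^sub>M I (\<lambda>_. lborel))"
    by measurable
qed

definition parent_Lipschitz :: "'a set \<Rightarrow> 'a set \<Rightarrow> ('a \<Rightarrow> 'a) \<Rightarrow> ('a \<Rightarrow> real) set" where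
  "parent_Lipschitz R T f = {y. \<forall>v\<in>T. \<bar>zero_on R y v - zero_on R y (f v)\<bar> \<le> 1}"

lemma measurable_parent_Lipschitz:
  assumes "finite T" "T \<subseteq> I" "f ` T \<subseteq> I \<union> R"
  shows "(\<lambda>y. indicator (parent_Lipschitz R T f) y :: ennreal)
    \<in> borel_measurable (Pi\<^sub>M I (\<lambda>_. lborel :: real measure))"
proof -
  let ?M = "Pi\<^sub>M I (\<lambda>_. lborel :: real measure)"
  have "{y \<in> space ?M. \<forall>e\<in>(\<lambda>v. (v, f v)) ` T. \<bar>zero_on R y (fst e) - zero_on R y (snd e)\<bar> \<le> 1} \<in> sets ?M"
    by (rule measurable_zero_on_Lipschitz) (use assms in auto)
  also have "{y \<in> space ?M. \<forall>e\<in>(\<lambda>v. (v, f v)) ` T. \<bar>zero_on R y (fst e) - zero_on R y (snd e)\<bar> \<le> 1}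
      = parent_Lipschitz R T f \<inter> space ?M"
    by (auto simp: parent_Lipschitz_def)
  finally show ?thesis by (simp add: borel_measurable_indicator_iff)
qed

text \<open>Integrate out the vertices of \<open>T\<close> in decreasing order of rank: each is confined to an
  interval of length 2 around its parent, which has smaller rank.\<close>

lemma nn_integral_parent_Lipschitz_le:
  fixes h :: "('a \<Rightarrow> real) \<Rightarrow> ennreal" and \<rho> :: "'a \<Rightarrow> nat"
  assumes "finite T" "finite W" "T \<inter> W = {}" "T \<inter> R = {}" "f ` T \<subseteq> T \<union> W \<union> R"
    and rank: "\<And>v. v \<in> T \<Longrightarrow> \<rho> (f v) < \<rho> v"
    and hm: "\<And>I. W \<subseteq> I \<Longrightarrow> h \<in> borel_measurable (Pi\<^sub>M I (\<lambda>_. lborel))"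
    and hcong: "\<And>x y. (\<And>v. v \<in> W \<Longrightarrow> x v = y v) \<Longrightarrow> h x = h y"
  shows "(\<integral>\<^sup>+y. indicator (parent_Lipschitz R T f) y * h y \<partial>Pi\<^sub>M (T \<union> W) (\<lambda>_. lborel))
    \<le> 2 ^ card T * (\<integral>\<^sup>+y. h y \<partial>Pi\<^sub>M W (\<lambda>_. lborel))"
  using assms(1,3-6)
proof (induction T rule: finite_ranking_induct[where f = \<rho>])
  case empty
  then show ?case by (simp add: parent_Lipschitz_def)
next
  case (insert l T)
  interpret product_sigma_finite "\<lambda>_ :: 'a. lborel :: real measure" by standard
  show ?case
  proof (cases "l \<in> T")
    case True
    then show ?thesis using insert.IH insert.prems by (simp add: insert_absorb)
  next
    case False
    have fl: "f l \<noteq> l" using insert.prems(4)[of l] by auto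
    \<comment> \<open>Since \<open>l\<close> has maximal rank it is the parent of no vertex of
      \<open>T\<close>, so its coordinate occurs only in its own constraint.\<close>
    have fT: "f v \<noteq> l" if "v \<in> T" for v
      using insert.prems(4)[of v] insert.hyps(2)[OF that] that by auto
    have lR: "l \<notin> R" and lW: "l \<notin> W \<union> T" using insert.prems False by auto
    have sub: "f ` T \<subseteq> T \<union> W \<union> R" using insert.prems(3) fT by blast
    have eq: "insert l T \<union> W = insert l (T \<union> W)" by simp
    have "(\<integral>\<^sup>+y. indicator (parent_Lipschitz R (insert l T) f) y * h y \<partial>Pi\<^sub>M (insert l T \<union> W) (\<lambda>_. lborel))
      = (\<integral>\<^sup>+y. \<integral>\<^sup>+a. indicator (parent_Lipschitz R (insert l T) f) (y(l := a)) * h (y(l := a)) \<partial>lborel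
          \<partial>Pi\<^sub>M (T \<union> W) (\<lambda>_. lborel))"
      unfolding eq
    proof (rule product_nn_integral_insert)
      show "(\<lambda>y. indicator (parent_Lipschitz R (insert l T) f) y * h y)
        \<in> borel_measurable (Pi\<^sub>M (insert l (T \<union> W)) (\<lambda>_. lborel))"
        using insert.prems(3) insert.hyps(1)
        by (intro borel_measurable_times_ennreal measurable_parent_Lipschitz hm) auto
    qed (use insert.hyps(1) \<open>finite W\<close> lW in auto)
    also have "\<dots> = (\<integral>\<^sup>+y. \<integral>\<^sup>+a. (indicator (parent_Lipschitz R T f) y * h y) *
          indicator {zero_on R y (f l) - 1..zero_on R y (f l) + 1} a \<partial>lborel
          \<partial>Pi\<^sub>M (T \<union> W) (\<lambda>_. lborel))"
    proof (intro nn_integral_cong)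
      fix y a
      have "h (y(l := a)) = h y" using lW by (intro hcong) auto
      moreover have "y(l := a) \<in> parent_Lipschitz R (insert l T) f \<longleftrightarrow>
          y \<in> parent_Lipschitz R T f \<and> a \<in> {zero_on R y (f l) - 1..zero_on R y (f l) + 1}"
      proof -
        have "(\<forall>v\<in>T. \<bar>zero_on R (y(l := a)) v - zero_on R (y(l := a)) (f v)\<bar> \<le> 1) \<longleftrightarrow>
            (\<forall>v\<in>T. \<bar>zero_on R y v - zero_on R y (f v)\<bar> \<le> 1)"
          using fT False by (intro ball_cong refl) (auto simp: zero_on_upd[OF lR])
        moreover have "\<bar>zero_on R (y(l := a)) l - zero_on R (y(l := a)) (f l)\<bar> = \<bar>a - zero_on R y (f l)\<bar>"
          using fl by (simp add: zero_on_upd[OF lR])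
        ultimately show ?thesis unfolding parent_Lipschitz_def by (auto simp: abs_le_iff)
      qed
      ultimately show "indicator (parent_Lipschitz R (insert l T) f) (y(l := a)) * h (y(l := a)) =
          (indicator (parent_Lipschitz R T f) y * h y) *
          indicator {zero_on R y (f l) - 1..zero_on R y (f l) + 1} a"
        by (auto simp: indicator_def)
    qed
    also have "\<dots> = (\<integral>\<^sup>+y. (indicator (parent_Lipschitz R T f) y * h y) * 2 \<partial>Pi\<^sub>M (T \<union> W) (\<lambda>_. lborel))"
      by (subst nn_integral_cmult_indicator) auto
    also have "\<dots> = (\<integral>\<^sup>+y. indicator (parent_Lipschitz R T f) y * h y \<partial>Pi\<^sub>M (T \<union> W) (\<lambda>_. lborel)) * 2"
      using sub insert.hyps(1)
      by (intro nn_integral_multc borel_measurable_times_ennreal measurable_parent_Lipschitz hm) auto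
    also have "\<dots> \<le> 2 ^ card T * (\<integral>\<^sup>+y. h y \<partial>Pi\<^sub>M W (\<lambda>_. lborel)) * 2"
      using insert.prems sub by (intro mult_right_mono insert.IH) auto
    also have "\<dots> = 2 ^ card (insert l T) * (\<integral>\<^sup>+y. h y \<partial>Pi\<^sub>M W (\<lambda>_. lborel))"
      using insert.hyps False by (simp add: ac_simps)
    finally show ?thesis .
  qed
qed

section \<open>Random edges and subset sums\<close>

lemma finite_vertex_pairs [simp]: "finite (vertex_pairs n)"
  unfolding vertex_pairs_def by (rule finite_subset[of _ "Pow {1..n}"]) auto

text \<open>Kept apart from the graph built on it, so that events become conditions on independent
  coordinates.\<close>

definition random_edges :: "nat \<Rightarrow> real \<Rightarrow> (nat set \<Rightarrow> bool) pmf" where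
  "random_edges n p = Pi_pmf (vertex_pairs n) False (\<lambda>_. bernoulli_pmf p)"

definition edge_graph :: "nat \<Rightarrow> (nat set \<Rightarrow> bool) \<Rightarrow> nat ugraph" where
  "edge_graph n X = ({1..n}, {e \<in> vertex_pairs n. X e})"

lemma erdos_renyi_conv: "erdos_renyi n p = map_pmf (edge_graph n) (random_edges n p)"
  by (simp add: erdos_renyi_def random_edges_def edge_graph_def[abs_def])

lemma finite_set_random_edges: "finite (set_pmf (random_edges n p))"
  unfolding random_edges_def
  by (rule finite_subset[OF set_Pi_pmf_subset']) (auto intro!: finite_PiE_dflt)

lemma prob_random_edges:
  assumes p: "0 \<le> p" "p \<le> 1" and "F \<subseteq> vertex_pairs n" "D \<subseteq> vertex_pairs n" "F \<inter> D = {}"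
  shows "measure_pmf.prob (random_edges n p) {X. (\<forall>e\<in>F. X e) \<and> (\<forall>e\<in>D. \<not> X e)}
    = p ^ card F * (1 - p) ^ card D"
proof -
  let ?B = "\<lambda>e. if e \<in> F then {True} else if e \<in> D then {False} else UNIV"
  have "{X. (\<forall>e\<in>F. X e) \<and> (\<forall>e\<in>D. \<not> X e)} = Pi (vertex_pairs n) ?B"
    using assms by (auto simp: Pi_def split: if_splits)
  then have "measure_pmf.prob (random_edges n p) {X. (\<forall>e\<in>F. X e) \<and> (\<forall>e\<in>D. \<not> X e)}
      = (\<Prod>e\<in>vertex_pairs n. measure_pmf.prob (bernoulli_pmf p) (?B e))"
    by (simp add: random_edges_def measure_Pi_pmf_Pi)
  also have "\<dots> = (\<Prod>e\<in>vertex_pairs n. (if e \<in> F then p else 1) * (if e \<in> D then 1 - p else 1))"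
    using assms by (intro prod.cong refl) (auto simp: measure_pmf_single)
  also have "\<dots> = p ^ card F * (1 - p) ^ card D"
    using assms by (simp add: prod.distrib prod.If_cases Int_absorb1)
  finally show ?thesis .
qed

lemma sum_Pow_power_card:
  fixes a :: real
  assumes "finite A"
  shows "(\<Sum>S\<in>Pow A. a ^ card S) = (1 + a) ^ card A"
  using prod_add[OF assms, of "\<lambda>_. a" "\<lambda>_. 1"] by (simp add: add.commute)

text \<open>Each size from 0 to \<open>card A\<close> contributes exactly 1. The denominator of
  \<open>mean_weight\<close> thus turns a sum over exponentially many splittings of the window into
  a linear factor.\<close>

lemma sum_Pow_inverse_binomial:
  assumes "finite A"
  shows "(\<Sum>K\<in>Pow A. 1 / real (card A choose card K)) = real (card A) + 1"
proof -
  have "(\<Sum>K\<in>Pow A. 1 / real (card A choose card K))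
    = (\<Sum>k\<in>{..card A}. \<Sum>K\<in>{K \<in> Pow A. card K = k}. 1 / real (card A choose card K))"
    by (rule sum.group[symmetric]) (use assms in \<open>auto intro: card_mono\<close>)
  also have "\<dots> = (\<Sum>k\<in>{..card A}. 1)"
  proof (intro sum.cong refl)
    fix k assume "k \<in> {..card A}"
    have "(\<Sum>K\<in>{K \<in> Pow A. card K = k}. 1 / real (card A choose card K))
        = (\<Sum>K\<in>{K. K \<subseteq> A \<and> card K = k}. 1 / real (card A choose k))"
      by (intro sum.cong) auto
    also have "\<dots> = 1" using \<open>k \<in> _\<close> by (simp add: n_subsets[OF assms])
    finally show "(\<Sum>K\<in>{K \<in> Pow A. card K = k}. 1 / real (card A choose card K)) = 1" .
  qed
  finally show ?thesis by simp
qed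

section \<open>Root sets, cuts and bad pairs\<close>

lemma root_reachable:
  assumes "is_root_set G R" "v \<in> verts G"
  shows "\<exists>r\<in>R. (v, r) \<in> {(a, b). {a, b} \<in> edges G}\<^sup>*"
proof -
  have "reachable G `` {v} \<in> graph_components G"
    unfolding graph_components_def using assms by (auto intro: quotientI)
  then have "\<exists>!r. r \<in> R \<inter> reachable G `` {v}"
    using assms(1)[unfolded is_root_set_def, THEN conjunct2] by (rule bspec[rotated])
  then show ?thesis by (auto simp: reachable_def)
qed

text \<open>The rank is the distance to the nearest root, and the parent is the next vertex on a
  shortest path. Decreasing ranks exclude cycles, which both the iterated integration and the count
  of parent edges rely on.\<close>

lemma root_set_parents:
  assumes "is_root_set G R"
  shows "\<exists>f (\<rho> :: 'a \<Rightarrow> nat). \<forall>v\<in>verts G - R. {v, f v} \<in> edges G \<and> \<rho> (f v) < \<rho> v"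
proof -
  let ?A = "{(a, b). {a, b} \<in> edges G}"
  define \<rho> where "\<rho> v = (LEAST k. \<exists>r\<in>R. (v, r) \<in> ?A ^^ k)" for v
  have "\<exists>z. {v, z} \<in> edges G \<and> \<rho> z < \<rho> v" if v: "v \<in> verts G - R" for v
  proof -
    have "\<exists>k. \<exists>r\<in>R. (v, r) \<in> ?A ^^ k"
      using root_reachable[OF assms] v rtrancl_imp_relpow by (metis DiffD1)
    then have "\<exists>r\<in>R. (v, r) \<in> ?A ^^ \<rho> v"
      unfolding \<rho>_def by (rule LeastI_ex)
    then obtain r where r: "r \<in> R" "(v, r) \<in> ?A ^^ \<rho> v" by blast
    obtain k where k: "\<rho> v = Suc k" using r v by (cases "\<rho> v") auto
    obtain z where z: "(v, z) \<in> ?A" "(z, r) \<in> ?A ^^ k"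
      using r(2) unfolding k by (blast dest: relpow_Suc_D2)
    have "\<rho> z \<le> k" unfolding \<rho>_def using z r by (intro Least_le) blast
    then show ?thesis using z k by auto
  qed
  then show ?thesis by metis
qed

text \<open>Some path to a root has at most as many steps as there are ordered adjacent pairs. The
  bound is crude, but it only has to keep the number of possible median positions
  polynomial.\<close>

lemma Lipschitz_le_card:
  assumes "finite_graph G" "is_root_set G R" "v \<in> verts G"
    and x0: "\<And>r. r \<in> R \<Longrightarrow> x r = 0"
    and lip: "\<And>u v. {u, v} \<in> edges G \<Longrightarrow> \<bar>x u - x v\<bar> \<le> (1 :: real)"
  shows "\<bar>x v\<bar> \<le> real (card (verts G) ^ 2)"
proof -
  let ?A = "{(a, b). {a, b} \<in> edges G}"
  have sub: "?A \<subseteq> verts G \<times> verts G" using assms(1) unfolding finite_graph_def by blast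
  have fin: "finite (verts G \<times> verts G)" using assms(1) by (simp add: finite_graph_def)
  then have finA: "finite ?A" using sub finite_subset by blast
  obtain r where r: "r \<in> R" "(v, r) \<in> ?A\<^sup>*" using root_reachable[OF assms(2,3)] by blast
  then obtain k where k: "k \<le> card ?A" "(v, r) \<in> ?A ^^ k"
    using rtrancl_finite_eq_relpow[OF finA] by auto
  have "\<bar>x v - x w\<bar> \<le> real k" if "(v, w) \<in> ?A ^^ k" for w k
    using that
  proof (induction k arbitrary: w)
    case (Suc k)
    then obtain z where z: "(v, z) \<in> ?A ^^ k" "{z, w} \<in> edges G" by auto
    then show ?case using Suc.IH[OF z(1)] lip[OF z(2)] by auto
  qed auto
  from this[OF k(2)] have "\<bar>x v\<bar> \<le> real k" using x0[OF r(1)] by simp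
  also have "k \<le> card (verts G) ^ 2"
    using k(1) card_mono[OF fin sub] by (simp add: card_cartesian_product power2_eq_square)
  finally show ?thesis by simp
qed

lemma root_in_component:
  assumes "is_root_set G R" "r \<in> R"
  shows "reachable G `` {r} \<in> graph_components G" "r \<in> reachable G `` {r}"
proof -
  have r: "r \<in> verts G" using assms by (auto simp: is_root_set_def)
  then show "reachable G `` {r} \<in> graph_components G"
    unfolding graph_components_def by (rule quotientI)
  show "r \<in> reachable G `` {r}" using r by (simp add: reachable_def)
qed

lemma roots_unique:
  assumes "is_root_set G R" "r \<in> R" "s \<in> R" "(r, s) \<in> reachable G"
  shows "r = s"
proof -
  have "\<exists>!t. t \<in> R \<inter> reachable G `` {r}"
    using assms(1)[unfolded is_root_set_def, THEN conjunct2] root_in_component(1)[OF assms(1,2)]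
    by (rule bspec)
  moreover have "r \<in> R \<inter> reachable G `` {r}" "s \<in> R \<inter> reachable G `` {r}"
    using assms root_in_component(2)[OF assms(1,2)] by auto
  ultimately show ?thesis by blast
qed

lemma card_root_set:
  assumes "is_root_set G R"
  shows "card R = card (graph_components G)"
proof (rule bij_betw_same_card[of "\<lambda>r. reachable G `` {r}"])
  show "bij_betw (\<lambda>r. reachable G `` {r}) R (graph_components G)"
    unfolding bij_betw_def
  proof (intro conjI inj_onI equalityI subsetI)
    fix r s assume "r \<in> R" "s \<in> R" and eq: "reachable G `` {r} = reachable G `` {s}"
    then have "(r, s) \<in> reachable G" using root_in_component(2)[OF assms] by blast
    then show "r = s" using roots_unique[OF assms] \<open>r \<in> R\<close> \<open>s \<in> R\<close> by blast
  next
    fix C assume "C \<in> (\<lambda>r. reachable G `` {r}) ` R"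
    then show "C \<in> graph_components G" using root_in_component(1)[OF assms] by blast
  next
    fix C assume C: "C \<in> graph_components G"
    then have "\<exists>!r. r \<in> R \<inter> C"
      using assms[unfolded is_root_set_def, THEN conjunct2] by (rule bspec[rotated])
    then obtain r where r: "r \<in> R" "r \<in> C" by blast
    obtain v where v: "C = reachable G `` {v}"
      using C unfolding graph_components_def by (rule quotientE)
    have "(v, r) \<in> reachable G" using r v by blast
    then have "C = reachable G `` {r}" unfolding v by (rule equiv_class_eq[OF equiv_reachable])
    then show "C \<in> (\<lambda>r. reachable G `` {r}) ` R" using r by blast
  qed
qed

text \<open>The union of the components of half of the roots has no edge to its complement. Each
  side contains at least \<open>card R div 2\<close> roots, and one of them has at most half of the
  vertices.\<close>

lemma root_set_balanced_cut:
  assumes fin: "finite_graph G" and R: "is_root_set G R"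
  shows "\<exists>A\<subseteq>verts G. card R div 2 \<le> card A \<and> 2 * card A \<le> card (verts G) \<and>
    (\<forall>u\<in>A. \<forall>v\<in>verts G - A. {u, v} \<notin> edges G)"
proof -
  have RV: "R \<subseteq> verts G" using R by (simp add: is_root_set_def)
  have finV: "finite (verts G)" using fin by (simp add: finite_graph_def)
  have finR: "finite R" using RV finV finite_subset by blast
  obtain R1 where R1: "R1 \<subseteq> R" "card R1 = card R div 2"
    using obtain_subset_with_card_n[of "card R div 2" R] by auto
  define A where "A = reachable G `` R1"
  have AV: "A \<subseteq> verts G" by (auto simp: A_def reachable_def)
  have R1A: "R1 \<subseteq> A" using R1 root_in_component(2)[OF R] unfolding A_def by blast
  have R2A: "R - R1 \<subseteq> verts G - A"
    using RV R1 roots_unique[OF R] unfolding A_def by blast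
  have c1: "card R div 2 \<le> card A"
    using card_mono[OF finite_subset[OF AV finV] R1A] R1 by simp
  have "card (R - R1) = card R - card R div 2" using R1 finR by (simp add: card_Diff_subset finite_subset)
  then have c2: "card R div 2 \<le> card (verts G - A)"
    using card_mono[OF _ R2A] finV by simp
  have cut: "{u, v} \<notin> edges G" if "u \<in> A" "v \<in> verts G - A" for u v
  proof
    assume "{u, v} \<in> edges G"
    then have "(u, v) \<in> reachable G" using that AV by (auto simp: reachable_def)
    moreover obtain r where "r \<in> R1" "(r, u) \<in> reachable G"
      using \<open>u \<in> A\<close> unfolding A_def by blast
    ultimately have "v \<in> A"
      using equiv_reachable[of G] unfolding A_def equiv_def by (blast dest: transD)
    then show False using that by simp
  qed
  have sum: "card A + card (verts G - A) = card (verts G)"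
    using AV finV by (metis card_Diff_subset card_mono finite_subset le_add_diff_inverse)
  show ?thesis
  proof (cases "2 * card A \<le> card (verts G)")
    case True
    then show ?thesis using AV c1 cut by blast
  next
    case False
    then have "2 * card (verts G - A) \<le> card (verts G)" using sum by simp
    moreover have "{u, v} \<notin> edges G" if "u \<in> verts G - A" "v \<in> verts G - (verts G - A)" for u v
      using cut[of v u] that by (auto simp: insert_commute)
    ultimately show ?thesis using c2 by (intro exI[of _ "verts G - A"]) blast
  qed
qed

section \<open>Medians and the bad pairs of a height function\<close>

lemma finite_max_attained:
  fixes x :: "'a \<Rightarrow> real"
  assumes "finite V" "V \<noteq> {}"
  shows "\<exists>z\<in>V. \<forall>v\<in>V. x v \<le> x z"
proof -
  have "Max (x ` V) \<in> x ` V" using assms by (intro Max_in) auto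
  then obtain z where "z \<in> V" "Max (x ` V) = x z" by auto
  then show ?thesis using assms by (metis Max_ge finite_imageI imageI)
qed

text \<open>Take the lowest \<open>w\<close> with at least half of the vertices at or below it. The
  highest vertex strictly below \<open>w\<close> fails this condition, so fewer than half lie
  strictly below \<open>w\<close>.\<close>

lemma median_exists:
  fixes x :: "'a \<Rightarrow> real"
  assumes "finite V" "V \<noteq> {}"
  shows "\<exists>w\<in>V. card V \<le> 2 * card {v\<in>V. x v \<le> x w} \<and> card V \<le> 2 * card {v\<in>V. x w \<le> x v}"
proof -
  define M where "M = {w\<in>V. card V \<le> 2 * card {v\<in>V. x v \<le> x w}}"
  have finM: "finite M" using assms by (simp add: M_def)
  obtain z where z: "z \<in> V" "\<And>v. v \<in> V \<Longrightarrow> x v \<le> x z"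
    using finite_max_attained[OF assms, of x] by blast
  then have "{v\<in>V. x v \<le> x z} = V" by auto
  then have "z \<in> M" using z by (simp add: M_def)
  then obtain w where w: "w \<in> M" "\<And>v. v \<in> M \<Longrightarrow> x w \<le> x v"
    using finite_max_attained[OF finM, of "\<lambda>v. - x v"] by auto
  have "card V \<le> 2 * card {v\<in>V. x w \<le> x v}"
  proof (cases "{v\<in>V. x v < x w} = {}")
    case True
    then have "{v\<in>V. x w \<le> x v} = V" by force
    then show ?thesis by simp
  next
    case False
    let ?B = "{v\<in>V. x v < x w}"
    obtain u where u: "u \<in> ?B" "\<And>v. v \<in> ?B \<Longrightarrow> x v \<le> x u"
      using finite_max_attained[OF _ False, of x] assms by auto
    have "u \<notin> M" using w(2)[of u] u by auto
    then have "2 * card {v\<in>V. x v \<le> x u} < card V" using u by (simp add: M_def)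
    moreover have "{v\<in>V. x v \<le> x u} = ?B" using u by fastforce
    moreover have "card V = card ?B + card {v\<in>V. x w \<le> x v}"
    proof -
      have "V = ?B \<union> {v\<in>V. x w \<le> x v}" by auto
      then show ?thesis using assms by (metis (no_types, lifting) card_Un_disjoint disjoint_iff finite_Un mem_Collect_eq not_le)
    qed
    ultimately show ?thesis by simp
  qed
  then show ?thesis using w by (auto simp: M_def)
qed

definition bad_pairs :: "nat \<Rightarrow> (nat \<Rightarrow> real) \<Rightarrow> nat set set" where
  "bad_pairs n x = {e \<in> vertex_pairs n. \<exists>u v. e = {u, v} \<and> 1 < \<bar>x u - x v\<bar>}"

lemma bad_pairs_subset: "bad_pairs n x \<subseteq> vertex_pairs n"
  by (auto simp: bad_pairs_def)

lemma bad_pairsI: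
  assumes "u \<in> {1..n}" "v \<in> {1..n}" "1 < \<bar>x u - x v\<bar>"
  shows "{u, v} \<in> bad_pairs n x"
proof -
  have "u \<noteq> v" using assms by auto
  then show ?thesis using assms by (auto simp: bad_pairs_def vertex_pairs_def)
qed

text \<open>Double counting of ordered pairs starting in \<open>S\<close>: one factor 2 comes from
  \<open>half\<close>, the other from the two orders in which a bad pair can be listed.\<close>

lemma card_bad_pairs_meeting:
  assumes S: "S \<subseteq> {1..n}"
    and half: "\<And>v. v \<in> S \<Longrightarrow> n \<le> 2 * card {u\<in>{1..n}. 1 < \<bar>x v - x u\<bar>}"
  shows "card S * n \<le> 4 * card {e \<in> bad_pairs n x. e \<inter> S \<noteq> {}}"
proof -
  let ?D = "{e \<in> bad_pairs n x. e \<inter> S \<noteq> {}}"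
  let ?Q = "Sigma S (\<lambda>v. {u\<in>{1..n}. 1 < \<bar>x v - x u\<bar>})"
  have finS: "finite S" using S finite_subset by blast
  have finD: "finite ?D"
    using finite_subset[OF bad_pairs_subset] by simp
  have "card S * n = (\<Sum>v\<in>S. n)" by simp
  also have "\<dots> \<le> (\<Sum>v\<in>S. 2 * card {u\<in>{1..n}. 1 < \<bar>x v - x u\<bar>})"
    by (intro sum_mono half)
  also have "\<dots> = 2 * card ?Q"
    using finS by (simp add: card_SigmaI sum_distrib_left)
  also have "card ?Q \<le> card (\<Union>e\<in>?D. {(a, b). {a, b} = e})"
  proof (rule card_mono)
    show "finite (\<Union>e\<in>?D. {(a, b). {a, b} = e})"
    proof (rule finite_subset)
      show "(\<Union>e\<in>?D. {(a, b). {a, b} = e}) \<subseteq> {1..n} \<times> {1..n}"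
        unfolding bad_pairs_def vertex_pairs_def by blast
    qed simp
    show "?Q \<subseteq> (\<Union>e\<in>?D. {(a, b). {a, b} = e})"
    proof
      fix z assume "z \<in> ?Q"
      then obtain v u where z: "z = (v, u)" "v \<in> S" "u \<in> {1..n}" "1 < \<bar>x v - x u\<bar>" by blast
      then have "{v, u} \<in> ?D" using S bad_pairsI[of v n u x] by auto
      then show "z \<in> (\<Union>e\<in>?D. {(a, b). {a, b} = e})" using z(1) by blast
    qed
  qed
  also have "\<dots> \<le> (\<Sum>e\<in>?D. card {(a, b). {a, b} = e})"
    by (rule card_UN_le[OF finD])
  also have "\<dots> \<le> (\<Sum>e\<in>?D. 2)"
  proof (rule sum_mono)
    fix e assume "e \<in> ?D"
    then obtain u v where e: "e = {u, v}" by (auto simp: bad_pairs_def)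
    have "{(a, b). {a, b} = e} \<subseteq> {(u, v), (v, u)}" by (auto simp: e doubleton_eq_iff)
    then have "card {(a, b). {a, b} = e} \<le> card {(u, v), (v, u)}" by (intro card_mono) auto
    also have "\<dots> \<le> 2" by (cases "u = v") auto
    finally show "card {(a, b). {a, b} = e} \<le> 2" .
  qed
  finally show ?thesis by simp
qed

text \<open>The upper interval starts at the grid point \<open>i / n\<close> and the lower one ends
  there. Rounding the median to a grid leaves polynomially many windows, and the extra length
  \<open>1 / n\<close> absorbs the rounding error.\<close>

abbreviation window_base :: "nat \<Rightarrow> int \<Rightarrow> nat set \<Rightarrow> nat \<Rightarrow> real" where
  "window_base n i K v \<equiv> (if v \<in> K then real_of_int i / real n else real_of_int i / real n - (1 + 1 / real n))"

text \<open>Two disjoint families of bad pairs are counted: those meeting the set \<open>S\<close>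
  of far vertices, at least \<open>card S * n / 4\<close> of them, and the inversions between the
  lower part \<open>U\<close> and the upper part \<open>K\<close> of the window. Roots are kept out
  of \<open>K\<close> and \<open>U\<close>, as their heights are not integrated; this only discards
  bad pairs.\<close>

lemma bad_pairs_weight_le:
  fixes x :: "nat \<Rightarrow> real"
  assumes p: "0 < p" "p < 1" and n: "0 < n" and N: "\<And>v. v \<in> {1..n} \<Longrightarrow> \<bar>x v\<bar> \<le> real (n ^ 2)"
  shows "\<exists>i\<in>{- int (n ^ 3) - 1..int (n ^ 3)}. \<exists>S\<subseteq>{1..n}. \<exists>K\<subseteq>{1..n} - S - R.
    (1 - p) ^ card (bad_pairs n x) \<le> exp (- (p * real n / 4)) ^ card S *
      separation_weight (1 - p) (window_base n i K) K ({1..n} - S - R - K) (1 + 1 / real n) x"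
proof -
  let ?V = "{1..n}"
  have "?V \<noteq> {}" using n by simp
  then obtain w where w: "w \<in> ?V" "n \<le> 2 * card {v\<in>?V. x v \<le> x w}" "n \<le> 2 * card {v\<in>?V. x w \<le> x v}"
    using median_exists[of ?V x] by auto
  define i where "i = \<lfloor>real n * x w\<rfloor>"
  define c where "c = real_of_int i / real n"
  \<comment> \<open>Since \<open>c \<le> x w < c + 1 / n\<close>, a vertex farther than
    \<open>L\<close> from \<open>c\<close> is more than 1 away from the median, and so from all
    vertices on the other side of it.\<close>
  define L where "L = 1 + 1 / real n"
  have i1: "real_of_int i \<le> real n * x w" "real n * x w < real_of_int i + 1"
    by (simp_all add: i_def)
  have c: "c \<le> x w" "x w < c + 1 / real n"
    using i1 n by (simp_all add: c_def field_simps)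
  have "\<bar>real n * x w\<bar> \<le> real n * real (n ^ 2)"
    unfolding abs_mult using N[OF w(1)] by (intro mult_mono) auto
  then have b: "\<bar>real n * x w\<bar> \<le> real (n ^ 3)" by (simp add: power3_eq_cube power2_eq_square)
  have "real_of_int i \<le> real_of_int (int (n ^ 3))" "real_of_int (- int (n ^ 3) - 1) \<le> real_of_int i"
    using i1 b unfolding of_int_diff of_int_minus of_int_of_nat_eq by (auto simp: abs_le_iff)
  then have i: "i \<in> {- int (n ^ 3) - 1..int (n ^ 3)}" unfolding of_int_le_iff by simp
  define S where "S = {v\<in>?V. L < \<bar>x v - c\<bar>}"
  define K where "K = {v\<in>?V - S - R. c \<le> x v}"
  define U where "U = ?V - S - R - K"
  define D where "D = {e \<in> bad_pairs n x. e \<inter> S \<noteq> {}}"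
  \<comment> \<open>Pairs at distance in the range from 1 to \<open>L\<close> are ignored, so that
    membership in \<open>P\<close> becomes a comparison of offsets.\<close>
  define P where "P = {(u, v)\<in>U \<times> K. L < x v - x u}"
  have L1: "1 \<le> L" by (simp add: L_def)
  have KU: "K \<subseteq> ?V" "U \<subseteq> ?V" "K \<inter> U = {}" "K \<inter> S = {}" "U \<inter> S = {}" "K \<subseteq> ?V - S - R"
    by (auto simp: K_def U_def)
  have fin: "finite K" "finite U" using KU finite_subset by blast+
  have finP: "finite P" by (rule finite_subset[of _ "U \<times> K"]) (use fin in \<open>auto simp: P_def\<close>)
  have finB: "finite (bad_pairs n x)" using finite_subset[OF bad_pairs_subset] by simp
  have D4: "card S * n \<le> 4 * card D"
    unfolding D_def
  proof (rule card_bad_pairs_meeting)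
    fix v assume v: "v \<in> S"
    then consider "c + L < x v" | "x v < c - L" unfolding S_def by force
    then show "n \<le> 2 * card {u\<in>?V. 1 < \<bar>x v - x u\<bar>}"
    proof cases
      case 1
      then have "{u\<in>?V. x u \<le> x w} \<subseteq> {u\<in>?V. 1 < \<bar>x v - x u\<bar>}" using c by (auto simp: L_def)
      then have "card {u\<in>?V. x u \<le> x w} \<le> card {u\<in>?V. 1 < \<bar>x v - x u\<bar>}" by (intro card_mono) auto
      then show ?thesis using w by linarith
    next
      case 2
      then have "{u\<in>?V. x w \<le> x u} \<subseteq> {u\<in>?V. 1 < \<bar>x v - x u\<bar>}"
        using c n by (auto simp: L_def)
      then have "card {u\<in>?V. x w \<le> x u} \<le> card {u\<in>?V. 1 < \<bar>x v - x u\<bar>}" by (intro card_mono) auto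
      then show ?thesis using w by linarith
    qed
  qed (auto simp: S_def)
  have inj: "inj_on (\<lambda>(u, v). {u, v}) P"
  proof (rule inj_onI, clarsimp)
    fix u v u' v' assume "(u, v) \<in> P" "(u', v') \<in> P" "{u, v} = {u', v'}"
    then show "u = u' \<and> v = v'" using KU(3) by (auto simp: P_def doubleton_eq_iff)
  qed
  have img: "(\<lambda>(u, v). {u, v}) ` P \<subseteq> {e \<in> bad_pairs n x. e \<inter> S = {}}"
  proof
    fix e assume "e \<in> (\<lambda>(u, v). {u, v}) ` P"
    then obtain u v where uv: "e = {u, v}" "u \<in> U" "v \<in> K" "L < x v - x u" by (auto simp: P_def)
    then have "e \<in> bad_pairs n x" using KU L1 by (auto intro!: bad_pairsI)
    then show "e \<in> {e \<in> bad_pairs n x. e \<inter> S = {}}" using uv KU by auto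
  qed
  have "card D + card P = card D + card ((\<lambda>(u, v). {u, v}) ` P)"
    by (simp add: card_image[OF inj])
  also have "\<dots> \<le> card D + card {e \<in> bad_pairs n x. e \<inter> S = {}}"
    using finB by (intro add_left_mono card_mono img) auto
  also have "\<dots> = card (D \<union> {e \<in> bad_pairs n x. e \<inter> S = {}})"
    using finB by (intro card_Un_disjoint[symmetric]) (auto simp: D_def)
  also have "D \<union> {e \<in> bad_pairs n x. e \<inter> S = {}} = bad_pairs n x" by (auto simp: D_def)
  finally have DP: "card D + card P \<le> card (bad_pairs n x)" .
  have weight: "separation_weight (1 - p) (window_base n i K) K U L x = (1 - p) ^ card P"
  proof -
    define \<beta> where "\<beta> = window_base n i K"
    have \<beta>K: "\<beta> v = c" if "v \<in> K" for v using that by (simp add: \<beta>_def c_def)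
    have \<beta>U: "\<beta> u = c - L" if "u \<in> U" for u
    proof -
      have "u \<notin> K" using that KU(3) by blast
      then show ?thesis by (simp add: \<beta>_def c_def L_def)
    qed
    have "\<beta> v \<le> x v \<and> x v \<le> \<beta> v + L" if "v \<in> K \<union> U" for v
    proof (cases "v \<in> K")
      case True
      then show ?thesis using \<beta>K[OF True] by (auto simp: K_def S_def)
    next
      case False
      then have "v \<in> U" using that by blast
      then show ?thesis using \<beta>U[of v] by (auto simp: U_def K_def S_def)
    qed
    then have "separation_weight (1 - p) \<beta> K U L x =
        (\<Prod>u\<in>U. \<Prod>v\<in>K. if x u - \<beta> u < x v - \<beta> v then 1 - p else 1)"
      unfolding separation_weight_def by (intro if_P) blast
    also have "\<dots> = (\<Prod>u\<in>U. \<Prod>v\<in>K. if (u, v) \<in> P then 1 - p else 1)"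
    proof (intro prod.cong refl)
      fix u v assume "u \<in> U" "v \<in> K"
      then have "x u - \<beta> u < x v - \<beta> v \<longleftrightarrow> (u, v) \<in> P"
        by (auto simp: P_def \<beta>K \<beta>U)
      then show "(if x u - \<beta> u < x v - \<beta> v then 1 - p else 1) = (if (u, v) \<in> P then 1 - p else 1)"
        by simp
    qed
    also have "\<dots> = (\<Prod>e\<in>U \<times> K. if e \<in> P then 1 - p else 1)"
      by (simp add: prod.cartesian_product)
    also have "\<dots> = (1 - p) ^ card P"
    proof -
      have "U \<times> K \<inter> P = P" by (auto simp: P_def)
      then show ?thesis using fin by (simp add: prod.If_cases)
    qed
    finally show ?thesis unfolding \<beta>_def .
  qed
  have "(1 - p) ^ card (bad_pairs n x) \<le> (1 - p) ^ (card D + card P)"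
    using p DP by (intro power_decreasing) auto
  also have "\<dots> = (1 - p) ^ card D * (1 - p) ^ card P" by (rule power_add)
  also have "\<dots> \<le> exp (- (p * real n / 4)) ^ card S * (1 - p) ^ card P"
  proof (rule mult_right_mono)
    have "(1 - p) ^ card D \<le> exp (- p) ^ card D"
      using p exp_ge_add_one_self[of "- p"] by (intro power_mono) auto
    also have "\<dots> = exp (- (p * real (card D)))" using exp_of_nat_mult[of "card D" "- p"] by (simp add: mult.commute)
    also have "\<dots> \<le> exp (- (p * (real (card S * n) / 4)))"
    proof -
      have "real (card S * n) \<le> real (4 * card D)" using D4 by (simp only: of_nat_le_iff)
      then have "real (card S * n) / 4 \<le> real (card D)" by simp
      then show ?thesis using p by (simp add: mult_left_mono)
    qed
    also have "\<dots> = exp (- (p * real n / 4)) ^ card S"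
      using exp_of_nat_mult[of "card S" "- (p * real n / 4)"] by (simp add: ac_simps)
    finally show "(1 - p) ^ card D \<le> exp (- (p * real n / 4)) ^ card S" .
  qed (use p in auto)
  finally have main: "(1 - p) ^ card (bad_pairs n x) \<le> exp (- (p * real n / 4)) ^ card S *
      separation_weight (1 - p) (window_base n i K) K (?V - S - R - K) (1 + 1 / real n) x"
    unfolding weight[symmetric] by (simp only: U_def L_def)
  have SV: "S \<subseteq> ?V" by (auto simp: S_def)
  show ?thesis
    by (rule bexI[OF _ i], rule exI[of _ S], rule conjI[OF SV], rule exI[of _ K], rule conjI[OF KU(6) main])
qed

section \<open>The expected volume\<close>

text \<open>Writes the constraints directly on the non-root coordinates, which makes measurability
  evident. For an upper bound it is enough that the projected polytope is contained in it.\<close>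

definition Lipschitz_set :: "'a ugraph \<Rightarrow> 'a set \<Rightarrow> ('a \<Rightarrow> real) set" where
  "Lipschitz_set G R = {y \<in> space (Pi\<^sub>M (verts G - R) (\<lambda>_. lborel)).
     \<forall>e\<in>{(u, v). {u, v} \<in> edges G}. \<bar>zero_on R y (fst e) - zero_on R y (snd e)\<bar> \<le> 1}"

lemma sets_Lipschitz_set:
  assumes "finite_graph G"
  shows "Lipschitz_set G R \<in> sets (Pi\<^sub>M (verts G - R) (\<lambda>_. lborel))"
  unfolding Lipschitz_set_def
proof (rule measurable_zero_on_Lipschitz)
  have sub: "{(u, v). {u, v} \<in> edges G} \<subseteq> verts G \<times> verts G"
    using assms unfolding finite_graph_def by blast
  show "finite {(u, v). {u, v} \<in> edges G}"
    by (rule finite_subset[OF sub]) (use assms in \<open>simp add: finite_graph_def\<close>)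
  fix u v assume "(u, v) \<in> {(u, v). {u, v} \<in> edges G}"
  then show "u \<in> verts G - R \<union> R \<and> v \<in> verts G - R \<union> R" using sub by blast
qed

lemma polytope_volume_le_emeasure:
  assumes fin: "finite_graph G"
  shows "ennreal (polytope_volume G R) \<le> emeasure (Pi\<^sub>M (verts G - R) (\<lambda>_. lborel)) (Lipschitz_set G R)"
proof -
  let ?M = "Pi\<^sub>M (verts G - R) (\<lambda>_. lborel :: real measure)"
  let ?P = "(\<lambda>x. restrict x (verts G - R)) ` lipschitz_polytope G R"
  have EV: "u \<in> verts G \<and> v \<in> verts G" if "{u, v} \<in> edges G" for u v
    using that fin unfolding finite_graph_def by blast
  have "?P \<subseteq> Lipschitz_set G R"
  proof
    fix y assume "y \<in> ?P"
    then obtain x where x: "x \<in> lipschitz_polytope G R" "y = restrict x (verts G - R)" by blast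
    have "zero_on R y w = x w" if "w \<in> verts G" for w
      using x that by (auto simp: zero_on_def lipschitz_polytope_def)
    then show "y \<in> Lipschitz_set G R" using x EV
      by (auto simp: Lipschitz_set_def space_PiM lipschitz_polytope_def)
  qed
  then have "emeasure ?M ?P \<le> emeasure ?M (Lipschitz_set G R)"
    by (intro emeasure_mono sets_Lipschitz_set[OF fin])
  \<comment> \<open>An inequality suffices and needs no finiteness: \<open>measure\<close> returns 0
    where \<open>emeasure\<close> is infinite.\<close>
  moreover have "ennreal (polytope_volume G R) \<le> emeasure ?M ?P"
    unfolding polytope_volume_def measure_def by (simp add: ennreal_enn2real_if)
  ultimately show ?thesis by simp
qed

section \<open>Union bound over parent maps and windows\<close>

text \<open>Candidates that do not refer to a graph, so that a union bound over them covers whatever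
  parents the random graph supplies. The rank is quantified inside for the same reason.\<close>

definition parent_maps :: "nat \<Rightarrow> nat set \<Rightarrow> (nat \<Rightarrow> nat) set" where
  "parent_maps n T = {f \<in> T \<rightarrow>\<^sub>E {1..n}. \<exists>\<rho> :: nat \<Rightarrow> nat. \<forall>v\<in>T. \<rho> (f v) < \<rho> v}"

lemma finite_parent_maps: "finite T \<Longrightarrow> finite (parent_maps n T)"
  unfolding parent_maps_def by (rule finite_subset[of _ "T \<rightarrow>\<^sub>E {1..n}"]) (auto intro: finite_PiE)

lemma card_parent_maps_le: "finite T \<Longrightarrow> card (parent_maps n T) \<le> n ^ card T"
proof -
  assume T: "finite T"
  have "card (parent_maps n T) \<le> card (T \<rightarrow>\<^sub>E {1..n})"
    unfolding parent_maps_def by (intro card_mono finite_PiE T) auto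
  then show ?thesis using T by (simp add: card_PiE)
qed

text \<open>Two vertices with the same parent edge would be parents of each other, against the rank.
  Distinct edges are what gives the full power \<open>p ^ card T\<close>.\<close>

lemma parent_edges:
  assumes "T \<subseteq> {1..n}" "f \<in> parent_maps n T"
  shows "(\<lambda>v. {v, f v}) ` T \<subseteq> vertex_pairs n" "card ((\<lambda>v. {v, f v}) ` T) = card T"
proof -
  obtain \<rho> :: "nat \<Rightarrow> nat" where \<rho>: "\<And>v. v \<in> T \<Longrightarrow> \<rho> (f v) < \<rho> v"
    using assms by (auto simp: parent_maps_def)
  have fV: "f v \<in> {1..n}" if "v \<in> T" for v
    using assms that by (auto simp: parent_maps_def)
  have ne: "f v \<noteq> v" if "v \<in> T" for v using \<rho>[OF that] by auto
  show "(\<lambda>v. {v, f v}) ` T \<subseteq> vertex_pairs n"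
  proof
    fix e assume "e \<in> (\<lambda>v. {v, f v}) ` T"
    then obtain v where v: "v \<in> T" "e = {v, f v}" by blast
    have "card e = 2" using ne[OF v(1)] v(2) by auto
    then show "e \<in> vertex_pairs n" using v assms(1) fV[OF v(1)] by (auto simp: vertex_pairs_def)
  qed
  have "inj_on (\<lambda>v. {v, f v}) T"
  proof (rule inj_onI)
    fix u v assume uv: "u \<in> T" "v \<in> T" "{u, f u} = {v, f v}"
    show "u = v"
    proof (rule ccontr)
      assume "u \<noteq> v"
      then have "u = f v" "v = f u" using uv(3) by (auto simp: doubleton_eq_iff)
      then have "\<rho> u < \<rho> v" "\<rho> v < \<rho> u" using \<rho>[OF uv(1)] \<rho>[OF uv(2)] by simp_all
      then show False by simp
    qed
  qed
  then show "card ((\<lambda>v. {v, f v}) ` T) = card T" by (rule card_image)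
qed

lemma finite_graph_edge_graph: "finite_graph (edge_graph n X)"
  by (auto simp: finite_graph_def edge_graph_def vertex_pairs_def)

lemma verts_edge_graph [simp]: "verts (edge_graph n X) = {1..n}"
  by (simp add: edge_graph_def)

lemma edges_edge_graph: "edges (edge_graph n X) = {e \<in> vertex_pairs n. X e}"
  by (simp add: edge_graph_def)

abbreviation window_weight :: "nat \<Rightarrow> real \<Rightarrow> nat set \<Rightarrow> int \<Rightarrow> nat set \<Rightarrow> nat set \<Rightarrow> (nat \<Rightarrow> real) \<Rightarrow> real" where
  "window_weight n p R i S K \<equiv>
     separation_weight (1 - p) (window_base n i K) K ({1..n} - S - R - K) (1 + 1 / real n)"

text \<open>The union bound term for grid position \<open>i\<close>, far vertices \<open>S\<close>,
  upper letters \<open>K\<close> and parent map \<open>f\<close>. Roots in \<open>S\<close> need no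
  parent, hence the exponent \<open>card (S - R)\<close> of \<open>p\<close>, while the bad pairs
  are charged to all of \<open>S\<close>.\<close>

definition confinement_weight ::
  "nat \<Rightarrow> real \<Rightarrow> nat set \<Rightarrow> int \<Rightarrow> nat set \<Rightarrow> nat set \<Rightarrow> (nat \<Rightarrow> nat) \<Rightarrow> (nat \<Rightarrow> real) \<Rightarrow> real" where
  "confinement_weight n p R i S K f y =
     indicator (parent_Lipschitz R (S - R) f) y *
       (p ^ card (S - R) * exp (- (p * real n / 4)) ^ card S * window_weight n p R i S K y)"

lemma confinement_weight_nonneg: "0 < p \<Longrightarrow> p < 1 \<Longrightarrow> 0 \<le> confinement_weight n p R i S K f y"
  unfolding confinement_weight_def
  by (intro mult_nonneg_nonneg separation_weight_nonneg) auto

text \<open>A vertex of \<open>S\<close> is far from the median, hence in many bad pairs, and pays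
  \<open>exp (- p n / 4)\<close>; it is joined to its parent with probability \<open>p\<close>.\<close>

lemma prob_Lipschitz_le:
  assumes p: "0 < p" "p < 1" and n: "0 < n"
  shows "measure_pmf.prob (random_edges n p)
      {X. is_root_set (edge_graph n X) R \<and> y \<in> Lipschitz_set (edge_graph n X) R}
    \<le> (\<Sum>i\<in>{- int (n ^ 3) - 1..int (n ^ 3)}. \<Sum>S\<in>Pow {1..n}. \<Sum>K\<in>Pow ({1..n} - S - R).
        \<Sum>f\<in>parent_maps n (S - R). confinement_weight n p R i S K f y)"
    (is "measure_pmf.prob _ ?E \<le> ?rhs")
proof (cases "?E = {}")
  case True
  have "measure_pmf.prob (random_edges n p) ?E = 0" by (simp only: True measure_empty)
  then show ?thesis
    by (simp add: sum_nonneg confinement_weight_nonneg[OF p])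
next
  case False
  let ?V = "{1..n}"
  define x where "x = zero_on R y"
  have lip: "\<bar>x u - x v\<bar> \<le> 1" if "X \<in> ?E" "{u, v} \<in> edges (edge_graph n X)" for X u v
    using that by (auto simp: Lipschitz_set_def x_def)
  \<comment> \<open>The point is arbitrary, but a single outcome in the event, which exists in this
    case, already confines it to the range of the grid.\<close>
  have bound: "\<bar>x v\<bar> \<le> real (n ^ 2)" if "v \<in> ?V" for v
  proof -
    obtain X where X: "X \<in> ?E" using False by blast
    have "\<bar>x v\<bar> \<le> real (card (verts (edge_graph n X)) ^ 2)"
      by (rule Lipschitz_le_card[of _ R])
        (use X that lip[OF X] in \<open>auto simp: finite_graph_edge_graph x_def zero_on_def\<close>)
    then show ?thesis by simp
  qed
  from bad_pairs_weight_le[where R = R and x = x, OF p n bound] obtain i S K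
    where i: "i \<in> {- int (n ^ 3) - 1..int (n ^ 3)}" and S: "S \<subseteq> ?V" and K: "K \<subseteq> ?V - S - R"
      and le: "(1 - p) ^ card (bad_pairs n x) \<le> exp (- (p * real n / 4)) ^ card S * window_weight n p R i S K x"
    by blast
  define T where "T = S - R"
  have T: "T \<subseteq> ?V" "finite T" "T \<inter> R = {}" using S by (auto simp: T_def intro: finite_subset)
  have wx: "window_weight n p R i S K x = window_weight n p R i S K y"
    by (rule separation_weight_cong) (use K in \<open>auto simp: x_def zero_on_def\<close>)
  define J where "J = {f \<in> parent_maps n T. y \<in> parent_Lipschitz R T f}"
  define Ev where "Ev f = {X. (\<forall>e\<in>(\<lambda>v. {v, f v}) ` T. X e) \<and> (\<forall>e\<in>bad_pairs n x. \<not> X e)}" for f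
  have "?E \<subseteq> (\<Union>f\<in>J. Ev f)"
  proof
    fix X assume X: "X \<in> ?E"
    then have root: "is_root_set (edge_graph n X) R" by simp
    obtain g \<rho> where g: "\<forall>v\<in>verts (edge_graph n X) - R. {v, g v} \<in> edges (edge_graph n X) \<and> (\<rho> (g v) :: nat) < \<rho> v"
      using root_set_parents[OF root] by blast
    define f where "f = restrict g T"
    have gT: "{v, f v} \<in> edges (edge_graph n X)" "\<rho> (f v) < \<rho> v" if "v \<in> T" for v
    proof -
      have "v \<in> verts (edge_graph n X) - R" using that T by auto
      then show "{v, f v} \<in> edges (edge_graph n X)" "\<rho> (f v) < \<rho> v"
        using g that by (auto simp: f_def)
    qed
    have fV: "f v \<in> ?V" if "v \<in> T" for v
      using gT(1)[OF that] unfolding edges_edge_graph vertex_pairs_def by blast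
    have "f \<in> T \<rightarrow>\<^sub>E ?V" using fV by (auto simp: f_def)
    then have fP: "f \<in> parent_maps n T" using gT(2) unfolding parent_maps_def by blast
    moreover have "y \<in> parent_Lipschitz R T f"
      using lip[OF X gT(1)] by (auto simp: parent_Lipschitz_def x_def)
    ultimately have "f \<in> J" by (simp add: J_def)
    moreover have "X e" if "e \<in> (\<lambda>v. {v, f v}) ` T" for e
      using that gT(1) unfolding edges_edge_graph by blast
    moreover have "\<not> X e" if e: "e \<in> bad_pairs n x" for e
    proof
      assume "X e"
      obtain u v where uv: "e = {u, v}" "1 < \<bar>x u - x v\<bar>" using e by (auto simp: bad_pairs_def)
      have "{u, v} \<in> edges (edge_graph n X)"
        using \<open>X e\<close> e uv bad_pairs_subset unfolding edges_edge_graph by blast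
      from lip[OF X this] uv show False by simp
    qed
    ultimately show "X \<in> (\<Union>f\<in>J. Ev f)" unfolding Ev_def by blast
  qed
  then have "measure_pmf.prob (random_edges n p) ?E \<le> measure_pmf.prob (random_edges n p) (\<Union>f\<in>J. Ev f)"
    by (intro measure_pmf.finite_measure_mono) auto
  also have "\<dots> \<le> (\<Sum>f\<in>J. measure_pmf.prob (random_edges n p) (Ev f))"
    using finite_parent_maps[OF T(2)]
    by (intro measure_pmf.finite_measure_subadditive_finite) (auto simp: J_def)
  also have "\<dots> \<le> (\<Sum>f\<in>J. confinement_weight n p R i S K f y)"
  proof (rule sum_mono)
    fix f assume f: "f \<in> J"
    then have fP: "f \<in> parent_maps n T" and fL: "y \<in> parent_Lipschitz R T f" by (auto simp: J_def)
    \<comment> \<open>A parent edge has length at most 1 and is therefore not a bad pair. Presence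
      and absence concern disjoint sets of edges, and the probabilities multiply.\<close>
    have "(\<lambda>v. {v, f v}) ` T \<inter> bad_pairs n x = {}"
    proof (rule ccontr)
      assume "(\<lambda>v. {v, f v}) ` T \<inter> bad_pairs n x \<noteq> {}"
      then obtain v where v: "v \<in> T" "{v, f v} \<in> bad_pairs n x" by blast
      then obtain a b where ab: "{v, f v} = {a, b}" "1 < \<bar>x a - x b\<bar>" by (auto simp: bad_pairs_def)
      have "\<bar>x v - x (f v)\<bar> \<le> 1" using fL v by (auto simp: parent_Lipschitz_def x_def)
      then show False using ab by (auto simp: doubleton_eq_iff abs_minus_commute)
    qed
    then have "measure_pmf.prob (random_edges n p) (Ev f) = p ^ card T * (1 - p) ^ card (bad_pairs n x)"
      unfolding Ev_def using p parent_edges[OF T(1) fP] bad_pairs_subset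
      by (subst prob_random_edges) auto
    also have "\<dots> \<le> p ^ card T * (exp (- (p * real n / 4)) ^ card S * window_weight n p R i S K x)"
      using p le by (intro mult_left_mono) auto
    also have "\<dots> = confinement_weight n p R i S K f y"
      using fL unfolding confinement_weight_def wx T_def by (simp add: mult.assoc)
    finally show "measure_pmf.prob (random_edges n p) (Ev f) \<le> confinement_weight n p R i S K f y" .
  qed
  also have "\<dots> \<le> (\<Sum>f\<in>parent_maps n (S - R). confinement_weight n p R i S K f y)"
    using finite_parent_maps[OF T(2)] confinement_weight_nonneg[OF p]
    by (intro sum_mono2) (auto simp: J_def T_def)
  \<comment> \<open>So far \<open>i\<close>, \<open>S\<close> and \<open>K\<close> were chosen for
    this particular \<open>y\<close>. Summing over all choices gives one bound for every
    \<open>y\<close>, which can be integrated term by term.\<close>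
  also have "\<dots> \<le> (\<Sum>K\<in>Pow (?V - S - R). \<Sum>f\<in>parent_maps n (S - R). confinement_weight n p R i S K f y)"
    by (rule member_le_sum[of K _ "\<lambda>K. \<Sum>f\<in>parent_maps n (S - R). confinement_weight n p R i S K f y"])
      (use K in \<open>auto intro!: sum_nonneg confinement_weight_nonneg[OF p]\<close>)
  also have "\<dots> \<le> (\<Sum>S\<in>Pow ?V. \<Sum>K\<in>Pow (?V - S - R). \<Sum>f\<in>parent_maps n (S - R). confinement_weight n p R i S K f y)"
    by (rule member_le_sum[of S _ "\<lambda>S. \<Sum>K\<in>Pow (?V - S - R). \<Sum>f\<in>parent_maps n (S - R). confinement_weight n p R i S K f y"])
      (use S in \<open>auto intro!: sum_nonneg confinement_weight_nonneg[OF p]\<close>)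
  also have "\<dots> \<le> ?rhs"
    by (rule member_le_sum[OF i, of "\<lambda>i. \<Sum>S\<in>Pow ?V. \<Sum>K\<in>Pow (?V - S - R). \<Sum>f\<in>parent_maps n (S - R). confinement_weight n p R i S K f y"])
      (auto intro!: sum_nonneg confinement_weight_nonneg[OF p])
  finally show ?thesis .
qed

text \<open>The far vertices are integrated out first, with a factor 2 each, and then the window by
  means of \<open>qbinomial_le\<close>. The enlarged interval length costs only
  \<open>(1 + 1 / n) ^ n \<le> exp 1\<close>.\<close>

lemma nn_integral_confinement_weight_le:
  assumes p: "0 < p" "p < 1" and n: "0 < n" and S: "S \<subseteq> {1..n}"
    and K: "K \<subseteq> {1..n} - S - R" and f: "f \<in> parent_maps n (S - R)"
  shows "(\<lambda>y. confinement_weight n p R i S K f y) \<in> borel_measurable (Pi\<^sub>M ({1..n} - R) (\<lambda>_. lborel))"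
    and "(\<integral>\<^sup>+y. ennreal (confinement_weight n p R i S K f y) \<partial>Pi\<^sub>M ({1..n} - R) (\<lambda>_. lborel))
    \<le> ennreal ((2 * p) ^ card (S - R) * exp (- (p * real n / 4)) ^ card S *
        (exp 1 * exp (pi\<^sup>2 / (6 * p))) / real (card ({1..n} - S - R) choose card K))"
proof -
  let ?T = "S - R" and ?W = "{1..n} - S - R"
  let ?U = "?W - K"
  let ?L = "1 + 1 / real n"
  let ?b = "real (card ?W choose card K)"
  have fin: "finite K" "finite ?U" "finite ?T" "finite ?W" using K S by (auto intro: finite_subset)
  have KU: "K \<union> ?U = ?W" "K \<inter> ?U = {}" using K by auto
  have TW: "?T \<union> ?W = {1..n} - R" using S by auto
  define a where "a = p ^ card ?T * exp (- (p * real n / 4)) ^ card S"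
  have a: "0 \<le> a" using p by (simp add: a_def)
  define h where "h y = ennreal a * ennreal (window_weight n p R i S K y)" for y
  have wm: "window_weight n p R i S K \<in> borel_measurable (Pi\<^sub>M I (\<lambda>_. lborel :: real measure))" if "?W \<subseteq> I" for I
    by (rule measurable_separation_weight) (use fin K that in auto)
  have hm: "h \<in> borel_measurable (Pi\<^sub>M I (\<lambda>_. lborel :: real measure))" if "?W \<subseteq> I" for I
    unfolding h_def using wm[OF that] by measurable
  have fV: "f ` ?T \<subseteq> ?T \<union> ?W \<union> R"
    using f S by (auto simp: parent_maps_def)
  have im: "(\<lambda>y. indicator (parent_Lipschitz R ?T f) y :: ennreal) \<in> borel_measurable (Pi\<^sub>M ({1..n} - R) (\<lambda>_. lborel :: real measure))"
    using fV fin S unfolding TW by (intro measurable_parent_Lipschitz) auto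
  then have "(\<lambda>y. indicator (parent_Lipschitz R ?T f) y :: real) \<in> borel_measurable (Pi\<^sub>M ({1..n} - R) (\<lambda>_. lborel :: real measure))"
    by (simp add: borel_measurable_indicator_iff)
  then show "(\<lambda>y. confinement_weight n p R i S K f y) \<in> borel_measurable (Pi\<^sub>M ({1..n} - R) (\<lambda>_. lborel))"
    unfolding confinement_weight_def using wm[of "{1..n} - R"]
    by (intro borel_measurable_times borel_measurable_const) auto
  obtain \<rho> :: "nat \<Rightarrow> nat" where \<rho>: "\<And>v. v \<in> ?T \<Longrightarrow> \<rho> (f v) < \<rho> v"
    using f by (auto simp: parent_maps_def)
  have "(\<integral>\<^sup>+y. ennreal (confinement_weight n p R i S K f y) \<partial>Pi\<^sub>M ({1..n} - R) (\<lambda>_. lborel))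
      = (\<integral>\<^sup>+y. indicator (parent_Lipschitz R ?T f) y * h y \<partial>Pi\<^sub>M (?T \<union> ?W) (\<lambda>_. lborel))"
    unfolding TW
  proof (intro nn_integral_cong)
    fix y
    have "0 \<le> window_weight n p R i S K y" using p by (intro separation_weight_nonneg) auto
    then show "ennreal (confinement_weight n p R i S K f y) = indicator (parent_Lipschitz R ?T f) y * h y"
      using a unfolding confinement_weight_def h_def a_def[symmetric]
      by (cases "y \<in> parent_Lipschitz R ?T f") (simp_all add: ennreal_mult)
  qed
  also have "\<dots> \<le> 2 ^ card ?T * (\<integral>\<^sup>+y. h y \<partial>Pi\<^sub>M ?W (\<lambda>_. lborel))"
  proof (rule nn_integral_parent_Lipschitz_le[where \<rho> = \<rho>])
    fix x y :: "nat \<Rightarrow> real" assume "\<And>v. v \<in> ?W \<Longrightarrow> x v = y v"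
    then have "window_weight n p R i S K x = window_weight n p R i S K y"
      using K by (intro separation_weight_cong) auto
    then show "h x = h y" by (simp add: h_def)
  qed (use fin fV hm \<rho> in auto)
  also have "(\<integral>\<^sup>+y. h y \<partial>Pi\<^sub>M ?W (\<lambda>_. lborel))
      = ennreal a * (\<integral>\<^sup>+y. ennreal (window_weight n p R i S K y) \<partial>Pi\<^sub>M (K \<union> ?U) (\<lambda>_. lborel))"
    unfolding h_def KU(1) using wm[of ?W] by (intro nn_integral_cmult) auto
  also have "2 ^ card ?T * \<dots> \<le> 2 ^ card ?T * (ennreal a * ennreal (?L ^ (card K + card ?U) * mean_weight (1 - p) (card K) (card ?U)))"
    by (intro mult_left_mono nn_integral_separation_weight_le) (use p fin in auto)
  also have "\<dots> \<le> 2 ^ card ?T * (ennreal a * ennreal (exp 1 * exp (pi\<^sup>2 / (6 * p)) / ?b))"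
  proof (intro mult_left_mono ennreal_leI)
    have cW: "card K + card ?U = card ?W"
      using card_Un_disjoint[OF fin(1,2) KU(2)] unfolding KU(1) by simp
    have "card ?W \<le> card {1..n}" by (intro card_mono) auto
    then have cn: "card ?W \<le> n" by simp
    have "?L ^ card ?W \<le> ?L ^ n" using cn by (intro power_increasing) auto
    also have "\<dots> \<le> exp (1 / real n) ^ n"
      using exp_ge_add_one_self[of "1 / real n"] by (intro power_mono) (auto intro: add_nonneg_nonneg)
    also have "\<dots> = exp 1" using n by (simp flip: exp_of_nat_mult)
    finally have 1: "?L ^ card ?W \<le> exp 1" .
    have 2: "mean_weight (1 - p) (card K) (card ?U) \<le> exp (pi\<^sup>2 / (6 * p)) / ?b"
      unfolding mean_weight_def cW using qbinomial_le[of "1 - p" "card K" "card ?U"] p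
      by (intro divide_right_mono) auto
    have "?L ^ card ?W * mean_weight (1 - p) (card K) (card ?U) \<le> exp 1 * (exp (pi\<^sup>2 / (6 * p)) / ?b)"
      by (intro mult_mono 1 2 mean_weight_nonneg) (use p in auto)
    then show "?L ^ (card K + card ?U) * mean_weight (1 - p) (card K) (card ?U) \<le> exp 1 * exp (pi\<^sup>2 / (6 * p)) / ?b"
      unfolding cW by simp
  qed auto
  also have "\<dots> = ennreal (2 ^ card ?T * (a * (exp 1 * exp (pi\<^sup>2 / (6 * p)) / ?b)))"
  proof -
    have "(2 :: ennreal) ^ card ?T = ennreal (2 ^ card ?T)"
      by (metis ennreal_numeral ennreal_power zero_le_numeral)
    then show ?thesis using a by (simp flip: ennreal_mult)
  qed
  also have "2 ^ card ?T * (a * (exp 1 * exp (pi\<^sup>2 / (6 * p)) / ?b)) = (2 * p) ^ card ?T * exp (- (p * real n / 4)) ^ card S *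
        (exp 1 * exp (pi\<^sup>2 / (6 * p))) / ?b"
    by (simp add: a_def power_mult_distrib)
  finally show "(\<integral>\<^sup>+y. ennreal (confinement_weight n p R i S K f y) \<partial>Pi\<^sub>M ({1..n} - R) (\<lambda>_. lborel))
    \<le> ennreal ((2 * p) ^ card (S - R) * exp (- (p * real n / 4)) ^ card S *
        (exp 1 * exp (pi\<^sup>2 / (6 * p))) / real (card ({1..n} - S - R) choose card K))" .
qed


text \<open>Expectation and volume integral are exchanged, and the confinement bounds are summed:
  \<open>2 * n ^ 3 + 2\<close> grid positions, a factor \<open>n + 1\<close> for the splittings of
  the window, and at most \<open>n ^ card (S - R)\<close> parent maps. The sum over \<open>S\<close>
  is a binomial expansion.\<close>

lemma expected_volume_le:
  assumes p: "0 < p" "p < 1" and n: "0 < n" and pn: "1 \<le> 2 * (p * real n)"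
  shows "(\<integral>\<^sup>+X. indicator {X. is_root_set (edge_graph n X) R} X *
        ennreal (polytope_volume (edge_graph n X) R) \<partial>random_edges n p)
    \<le> ennreal (real (2 * n ^ 3 + 2) * (real n + 1) * exp 1 *
        exp (pi\<^sup>2 / (6 * p)) * (1 + 2 * (p * real n) * exp (- (p * real n / 4))) ^ n)"
proof -
  let ?V = "{1..n}"
  let ?M = "Pi\<^sub>M (?V - R) (\<lambda>_. lborel :: real measure)"
  let ?\<mu> = "random_edges n p"
  let ?I = "{- int (n ^ 3) - 1..int (n ^ 3)}"
  let ?G = "edge_graph n"
  let ?Q = "exp 1 * exp (pi\<^sup>2 / (6 * p))"
  let ?x = "exp (- (p * real n / 4))"
  let ?w = "confinement_weight n p R"
  note fin = finite_set_random_edges[of n p]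
  have Lm: "Lipschitz_set (?G X) R \<in> sets ?M" for X
    using sets_Lipschitz_set[OF finite_graph_edge_graph, of n X R] by simp
  have "(\<integral>\<^sup>+X. indicator {X. is_root_set (?G X) R} X * ennreal (polytope_volume (?G X) R) \<partial>?\<mu>)
      = (\<Sum>X\<in>set_pmf ?\<mu>. indicator {X. is_root_set (?G X) R} X * ennreal (polytope_volume (?G X) R) * ennreal (pmf ?\<mu> X))"
    by (rule nn_integral_measure_pmf_finite[OF fin]) simp
  also have "\<dots> \<le> (\<Sum>X\<in>set_pmf ?\<mu>. \<integral>\<^sup>+y. indicator {X. is_root_set (?G X) R \<and> y \<in> Lipschitz_set (?G X) R} X * ennreal (pmf ?\<mu> X) \<partial>?M)"
  proof (rule sum_mono)
    fix X
    have "indicator {X. is_root_set (?G X) R} X * ennreal (polytope_volume (?G X) R) * ennreal (pmf ?\<mu> X)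
        \<le> indicator {X. is_root_set (?G X) R} X * emeasure ?M (Lipschitz_set (?G X) R) * ennreal (pmf ?\<mu> X)"
      using polytope_volume_le_emeasure[OF finite_graph_edge_graph, of n X R]
      by (intro mult_right_mono mult_left_mono) auto
    also have "\<dots> = (indicator {X. is_root_set (?G X) R} X * ennreal (pmf ?\<mu> X)) * (\<integral>\<^sup>+y. indicator (Lipschitz_set (?G X) R) y \<partial>?M)"
      using Lm[of X] by (simp add: ac_simps)
    also have "\<dots> = (\<integral>\<^sup>+y. (indicator {X. is_root_set (?G X) R} X * ennreal (pmf ?\<mu> X)) * indicator (Lipschitz_set (?G X) R) y \<partial>?M)"
      using Lm[of X] by (intro nn_integral_cmult[symmetric] borel_measurable_indicator)
    also have "\<dots> = (\<integral>\<^sup>+y. indicator {X. is_root_set (?G X) R \<and> y \<in> Lipschitz_set (?G X) R} X * ennreal (pmf ?\<mu> X) \<partial>?M)"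
      by (intro nn_integral_cong) (auto simp: indicator_def)
    finally show "indicator {X. is_root_set (?G X) R} X * ennreal (polytope_volume (?G X) R) * ennreal (pmf ?\<mu> X)
      \<le> (\<integral>\<^sup>+y. indicator {X. is_root_set (?G X) R \<and> y \<in> Lipschitz_set (?G X) R} X * ennreal (pmf ?\<mu> X) \<partial>?M)" .
  qed
  also have "\<dots> = (\<integral>\<^sup>+y. (\<Sum>X\<in>set_pmf ?\<mu>. indicator {X. is_root_set (?G X) R \<and> y \<in> Lipschitz_set (?G X) R} X * ennreal (pmf ?\<mu> X)) \<partial>?M)"
  proof (rule nn_integral_sum[symmetric])
    fix X
    have "indicator {X. is_root_set (?G X) R \<and> y \<in> Lipschitz_set (?G X) R} X * ennreal (pmf ?\<mu> X)
      = indicator {X. is_root_set (?G X) R} X * indicator (Lipschitz_set (?G X) R) y * ennreal (pmf ?\<mu> X)" for y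
      by (auto simp: indicator_def)
    moreover have "(\<lambda>y. indicator {X. is_root_set (?G X) R} X * indicator (Lipschitz_set (?G X) R) y * ennreal (pmf ?\<mu> X))
        \<in> borel_measurable ?M"
      using Lm[of X] by (intro borel_measurable_times_ennreal borel_measurable_const borel_measurable_indicator)
    ultimately show "(\<lambda>y. indicator {X. is_root_set (?G X) R \<and> y \<in> Lipschitz_set (?G X) R} X * ennreal (pmf ?\<mu> X)) \<in> borel_measurable ?M"
      by (simp only:)
  qed
  also have "\<dots> = (\<integral>\<^sup>+y. ennreal (measure_pmf.prob ?\<mu> {X. is_root_set (?G X) R \<and> y \<in> Lipschitz_set (?G X) R}) \<partial>?M)"
    by (intro nn_integral_cong)
      (simp add: nn_integral_measure_pmf_finite[OF fin, symmetric] measure_pmf.emeasure_eq_measure)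
  also have "\<dots> \<le> (\<integral>\<^sup>+y. (\<Sum>i\<in>?I. \<Sum>S\<in>Pow ?V. \<Sum>K\<in>Pow (?V - S - R). \<Sum>f\<in>parent_maps n (S - R). ennreal (?w i S K f y)) \<partial>?M)"
  proof (intro nn_integral_mono)
    fix y
    show "ennreal (measure_pmf.prob ?\<mu> {X. is_root_set (?G X) R \<and> y \<in> Lipschitz_set (?G X) R})
      \<le> (\<Sum>i\<in>?I. \<Sum>S\<in>Pow ?V. \<Sum>K\<in>Pow (?V - S - R). \<Sum>f\<in>parent_maps n (S - R). ennreal (?w i S K f y))"
      using ennreal_leI[OF prob_Lipschitz_le[where R = R and y = y, OF p n]]
      by (simp add: sum_ennreal sum_nonneg confinement_weight_nonneg[OF p])
  qed
  also have "\<dots> = (\<Sum>i\<in>?I. \<Sum>S\<in>Pow ?V. \<Sum>K\<in>Pow (?V - S - R). \<Sum>f\<in>parent_maps n (S - R). \<integral>\<^sup>+y. ennreal (?w i S K f y) \<partial>?M)"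
  proof -
    have m: "(\<lambda>y. ennreal (?w i S K f y)) \<in> borel_measurable ?M"
      if "S \<in> Pow ?V" "K \<in> Pow (?V - S - R)" "f \<in> parent_maps n (S - R)" for i S K f
      using nn_integral_confinement_weight_le(1)[OF p n, of S K R f i] that by simp
    show ?thesis
      apply (subst nn_integral_sum, intro borel_measurable_sum m, assumption+)
      apply (rule sum.cong[OF refl])
      apply (subst nn_integral_sum, intro borel_measurable_sum m, assumption+)
      apply (rule sum.cong[OF refl])
      apply (subst nn_integral_sum, intro borel_measurable_sum m, assumption+)
      apply (rule sum.cong[OF refl])
      apply (subst nn_integral_sum, intro m, assumption+)
      apply (rule refl)
      done
  qed
  also have "\<dots> \<le> (\<Sum>i\<in>?I. \<Sum>S\<in>Pow ?V. \<Sum>K\<in>Pow (?V - S - R). \<Sum>f\<in>parent_maps n (S - R).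
      ennreal ((2 * p) ^ card (S - R) * ?x ^ card S * ?Q / real (card (?V - S - R) choose card K)))"
    by (intro sum_mono nn_integral_confinement_weight_le(2)[OF p n]) auto
  also have "\<dots> = ennreal (\<Sum>i\<in>?I. \<Sum>S\<in>Pow ?V. \<Sum>K\<in>Pow (?V - S - R). \<Sum>f\<in>parent_maps n (S - R).
      (2 * p) ^ card (S - R) * ?x ^ card S * ?Q / real (card (?V - S - R) choose card K))"
  proof -
    have nn: "0 \<le> (2 * p) ^ card (S - R) * ?x ^ card S * ?Q / real (card (?V - S - R) choose card K)" for S K
      using p by (intro divide_nonneg_nonneg mult_nonneg_nonneg) auto
    show ?thesis by (simp only: sum_ennreal sum_nonneg nn)
  qed
  also have "\<dots> \<le> ennreal (\<Sum>i\<in>?I. \<Sum>S\<in>Pow ?V. (2 * (p * real n) * ?x) ^ card S * ?Q * (real n + 1))"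
  proof (intro ennreal_leI sum_mono)
    fix S assume S: "S \<in> Pow ?V"
    let ?T = "S - R" and ?W = "?V - S - R"
    have finT: "finite ?T" using S by (auto intro: finite_subset)
    have finW: "finite ?W" by simp
    have "(2 * p) ^ card ?T * real (card (parent_maps n ?T)) \<le> (2 * p) ^ card ?T * real n ^ card ?T"
    proof (intro mult_left_mono)
      show "real (card (parent_maps n ?T)) \<le> real n ^ card ?T"
        using card_parent_maps_le[OF finT, of n] by (metis of_nat_le_iff of_nat_power)
    qed (use p in auto)
    also have "\<dots> = (2 * (p * real n)) ^ card ?T" by (simp add: power_mult_distrib)
    \<comment> \<open>By \<open>pn\<close> the base is at least 1. Raising the exponent from
      \<open>card (S - R)\<close> to \<open>card S\<close> removes the dependence on
      \<open>R\<close>.\<close>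
    also have "\<dots> \<le> (2 * (p * real n)) ^ card S"
      using pn S by (intro power_increasing card_mono) (auto intro: finite_subset)
    finally have A: "(2 * p) ^ card ?T * real (card (parent_maps n ?T)) \<le> (2 * (p * real n)) ^ card S" .
    have "card ?W \<le> card ?V" by (intro card_mono) auto
    then have cW: "real (card ?W) + 1 \<le> real n + 1" by simp
    have "(\<Sum>K\<in>Pow ?W. \<Sum>f\<in>parent_maps n ?T. (2 * p) ^ card ?T * ?x ^ card S * ?Q / real (card ?W choose card K))
      = (\<Sum>K\<in>Pow ?W. ((2 * p) ^ card ?T * real (card (parent_maps n ?T))) * ?x ^ card S * ?Q * (1 / real (card ?W choose card K)))"
      by (simp add: ac_simps)
    also have "\<dots> = ((2 * p) ^ card ?T * real (card (parent_maps n ?T))) * ?x ^ card S * ?Q * (real (card ?W) + 1)"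
      unfolding sum_distrib_left[symmetric] sum_Pow_inverse_binomial[OF finW] ..
    also have "\<dots> \<le> (2 * (p * real n)) ^ card S * ?x ^ card S * ?Q * (real n + 1)"
      by (intro mult_mono A cW order_refl mult_nonneg_nonneg) (use p in auto)
    also have "\<dots> = (2 * (p * real n) * ?x) ^ card S * ?Q * (real n + 1)"
      by (simp only: power_mult_distrib)
    finally show "(\<Sum>K\<in>Pow ?W. \<Sum>f\<in>parent_maps n ?T. (2 * p) ^ card ?T * ?x ^ card S * ?Q / real (card ?W choose card K))
      \<le> (2 * (p * real n) * ?x) ^ card S * ?Q * (real n + 1)" .
  qed
  also have "(\<Sum>i\<in>?I. \<Sum>S\<in>Pow ?V. (2 * (p * real n) * ?x) ^ card S * ?Q * (real n + 1))
      = real (card ?I) * (\<Sum>S\<in>Pow ?V. (2 * (p * real n) * ?x) ^ card S) * (?Q * (real n + 1))"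
    by (simp only: sum_constant sum_distrib_right[symmetric] mult.assoc)
  also have "\<dots> = real (2 * n ^ 3 + 2) * (real n + 1) * exp 1 * exp (pi\<^sup>2 / (6 * p)) * (1 + 2 * (p * real n) * ?x) ^ n"
  proof -
    have "card ?I = nat (int (2 * n ^ 3 + 2))" by simp
    then have "card ?I = 2 * n ^ 3 + 2" by (simp only: nat_int)
    moreover have "(\<Sum>S\<in>Pow ?V. (2 * (p * real n) * ?x) ^ card S) = (1 + 2 * (p * real n) * ?x) ^ n"
      by (subst sum_Pow_power_card) auto
    ultimately show ?thesis by (simp only: ac_simps)
  qed
  finally show ?thesis .
qed

section \<open>Few components with high probability\<close>

text \<open>Many roots force a balanced cut without edges. The smaller side \<open>A\<close> has at
  least \<open>card A * n / 2\<close> pairs across the cut, and a union bound over \<open>A\<close>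
  follows.\<close>

lemma prob_many_roots_le:
  assumes p: "0 \<le> p" "p \<le> 1"
  shows "measure_pmf.prob (random_edges n p) {X. \<exists>R. is_root_set (edge_graph n X) R \<and> 2 * a \<le> card R}
    \<le> exp (- real a) * (1 + exp (1 - p * real n / 2)) ^ n"
proof -
  let ?V = "{1..n}"
  define J where "J = {A. A \<subseteq> ?V \<and> a \<le> card A \<and> 2 * card A \<le> n}"
  define D where "D A = (\<lambda>(u, v). {u, v}) ` (A \<times> (?V - A))" for A
  define Ev where "Ev A = {X. (\<forall>e\<in>{}. X e) \<and> (\<forall>e\<in>D A. \<not> X e)}" for A
  have finJ: "finite J" by (rule finite_subset[of _ "Pow ?V"]) (auto simp: J_def)
  have "{X. \<exists>R. is_root_set (edge_graph n X) R \<and> 2 * a \<le> card R} \<subseteq> (\<Union>A\<in>J. Ev A)"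
  proof
    fix X assume "X \<in> {X. \<exists>R. is_root_set (edge_graph n X) R \<and> 2 * a \<le> card R}"
    then obtain R where R: "is_root_set (edge_graph n X) R" "2 * a \<le> card R" by blast
    obtain A where A: "A \<subseteq> ?V" "card R div 2 \<le> card A" "2 * card A \<le> n"
      and cut: "\<And>u v. u \<in> A \<Longrightarrow> v \<in> ?V - A \<Longrightarrow> {u, v} \<notin> edges (edge_graph n X)"
      using root_set_balanced_cut[OF finite_graph_edge_graph R(1)] by auto
    have "A \<in> J" using A R(2) by (auto simp: J_def)
    moreover have "\<not> X e" if e: "e \<in> D A" for e
    proof -
      obtain u v where uv: "e = {u, v}" "u \<in> A" "v \<in> ?V - A" using e unfolding D_def by auto
      then have "u \<noteq> v" by auto
      then have "e \<in> vertex_pairs n" using uv A by (auto simp: vertex_pairs_def)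
      then show ?thesis using cut[OF uv(2,3)] uv(1) unfolding edges_edge_graph by auto
    qed
    ultimately show "X \<in> (\<Union>A\<in>J. Ev A)" unfolding Ev_def by blast
  qed
  then have "measure_pmf.prob (random_edges n p) {X. \<exists>R. is_root_set (edge_graph n X) R \<and> 2 * a \<le> card R}
      \<le> measure_pmf.prob (random_edges n p) (\<Union>A\<in>J. Ev A)"
    by (intro measure_pmf.finite_measure_mono) auto
  also have "\<dots> \<le> (\<Sum>A\<in>J. measure_pmf.prob (random_edges n p) (Ev A))"
    using finJ by (intro measure_pmf.finite_measure_subadditive_finite) auto
  also have "\<dots> \<le> (\<Sum>A\<in>J. exp (- real a) * exp (1 - p * real n / 2) ^ card A)"
  proof (rule sum_mono)
    fix A assume "A \<in> J"
    then have A: "A \<subseteq> ?V" "a \<le> card A" "2 * card A \<le> n" by (auto simp: J_def)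
    have finA: "finite A" using A finite_subset by blast
    have Dsub: "D A \<subseteq> vertex_pairs n"
    proof
      fix e assume "e \<in> D A"
      then obtain u v where uv: "e = {u, v}" "u \<in> A" "v \<in> ?V - A" unfolding D_def by auto
      then have "u \<noteq> v" by auto
      then show "e \<in> vertex_pairs n" using uv A by (auto simp: vertex_pairs_def)
    qed
    have "inj_on (\<lambda>(u, v). {u, v}) (A \<times> (?V - A))"
      by (auto simp: inj_on_def doubleton_eq_iff)
    then have cD: "card (D A) = card A * (n - card A)"
      unfolding D_def using A finA by (simp add: card_image card_cartesian_product card_Diff_subset)
    have "measure_pmf.prob (random_edges n p) (Ev A) = (1 - p) ^ card (D A)"
      unfolding Ev_def using prob_random_edges[OF p, of "{}" n "D A"] Dsub by simp
    also have "\<dots> \<le> exp (- p) ^ card (D A)"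
      using p exp_ge_add_one_self[of "- p"] by (intro power_mono) auto
    also have "\<dots> = exp (- (p * (real (card A) * (real n - real (card A)))))"
      using exp_of_nat_mult[of "card (D A)" "- p"] A by (simp add: cD of_nat_diff ac_simps)
    also have "\<dots> \<le> exp (- (p * (real (card A) * (real n / 2))))"
    proof -
      have "real (2 * card A) \<le> real n" using A(3) by (simp only: of_nat_le_iff)
      then have "real (card A) * (real n / 2) \<le> real (card A) * (real n - real (card A))"
        by (intro mult_left_mono) auto
      from mult_left_mono[OF this p(1)] show ?thesis by simp
    qed
    \<comment> \<open>Inserts the factor \<open>exp (card A - a)\<close>, at least 1 as
      \<open>a \<le> card A\<close>. It yields the gain \<open>exp (- a)\<close> even after the sum
      is extended to all subsets.\<close>
    also have "\<dots> \<le> exp (- real a) * exp (real (card A) * (1 - p * real n / 2))"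
      unfolding exp_add[symmetric] using A(2) by (simp add: algebra_simps)
    also have "\<dots> = exp (- real a) * exp (1 - p * real n / 2) ^ card A"
      by (simp only: exp_of_nat_mult)
    finally show "measure_pmf.prob (random_edges n p) (Ev A) \<le> exp (- real a) * exp (1 - p * real n / 2) ^ card A" .
  qed
  also have "\<dots> \<le> (\<Sum>A\<in>Pow ?V. exp (- real a) * exp (1 - p * real n / 2) ^ card A)"
    by (intro sum_mono2) (auto simp: J_def)
  also have "\<dots> = exp (- real a) * (1 + exp (1 - p * real n / 2)) ^ n"
    unfolding sum_distrib_left[symmetric] sum_Pow_power_card[OF finite_atLeastAtMost] by simp
  finally show ?thesis .
qed

section \<open>Growth constants of random graphs\<close>

text \<open>Markov's inequality for the volume, restricted to the outcomes that have
  \<open>R\<close> as a root set.\<close>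

lemma prob_large_volume_le:
  assumes p: "0 < p" "p < 1" and n: "0 < n" and pn: "1 \<le> 2 * (p * real n)"
  shows "measure_pmf.prob (random_edges n p)
      {X. is_root_set (edge_graph n X) R \<and> exp b \<le> polytope_volume (edge_graph n X) R}
    \<le> real (2 * n ^ 3 + 2) * (real n + 1) * exp 1 *
        exp (pi\<^sup>2 / (6 * p)) * (1 + 2 * (p * real n) * exp (- (p * real n / 4))) ^ n * exp (- b)"
    (is "?prob \<le> ?B * exp (- b)")
proof -
  let ?F = "{X. is_root_set (edge_graph n X) R \<and> exp b \<le> polytope_volume (edge_graph n X) R}"
  have B: "0 \<le> ?B" using p by (intro mult_nonneg_nonneg) auto
  have "ennreal (exp b * ?prob) = ennreal (exp b) * emeasure (random_edges n p) ?F"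
    by (simp add: measure_pmf.emeasure_eq_measure ennreal_mult)
  also have "\<dots> = (\<integral>\<^sup>+X. ennreal (exp b) * indicator ?F X \<partial>random_edges n p)"
    by (simp add: nn_integral_cmult_indicator)
  also have "\<dots> \<le> (\<integral>\<^sup>+X. indicator {X. is_root_set (edge_graph n X) R} X *
        ennreal (polytope_volume (edge_graph n X) R) \<partial>random_edges n p)"
    by (intro nn_integral_mono) (auto simp: indicator_def intro!: ennreal_leI)
  also have "\<dots> \<le> ennreal ?B" by (rule expected_volume_le[OF assms])
  finally have "exp b * ?prob \<le> ?B" using B by (simp only: ennreal_le_iff)
  then have "exp b * ?prob * exp (- b) \<le> ?B * exp (- b)" by (intro mult_right_mono) auto
  then show ?thesis by (simp add: exp_minus field_simps)
qed

text \<open>Exponential tilting: every counted set has weight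
  \<open>exp (s * (t - card R)) \<ge> 1\<close>, and the weights sum to a binomial expansion over
  all subsets.\<close>

lemma card_small_subsets_le:
  assumes "finite V" "0 \<le> s"
  shows "real (card {R. R \<subseteq> V \<and> real (card R) \<le> t}) \<le> exp (s * t) * (1 + exp (- s)) ^ card V"
proof -
  have fin: "finite {R. R \<subseteq> V \<and> real (card R) \<le> t}" using assms by simp
  have "real (card {R. R \<subseteq> V \<and> real (card R) \<le> t}) = (\<Sum>R\<in>{R. R \<subseteq> V \<and> real (card R) \<le> t}. 1)" by simp
  also have "\<dots> \<le> (\<Sum>R\<in>{R. R \<subseteq> V \<and> real (card R) \<le> t}. exp (s * t) * exp (- s) ^ card R)"
  proof (rule sum_mono)
    fix R assume "R \<in> {R. R \<subseteq> V \<and> real (card R) \<le> t}"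
    then have "s * real (card R) \<le> s * t" using assms by (intro mult_left_mono) auto
    then have "1 \<le> exp (s * t + real (card R) * (- s))" by (simp add: ac_simps)
    then show "1 \<le> exp (s * t) * exp (- s) ^ card R" by (simp only: exp_add exp_of_nat_mult)
  qed
  also have "\<dots> \<le> (\<Sum>R\<in>Pow V. exp (s * t) * exp (- s) ^ card R)"
    using assms by (intro sum_mono2) auto
  also have "\<dots> = exp (s * t) * (1 + exp (- s)) ^ card V"
    unfolding sum_distrib_left[symmetric] sum_Pow_power_card[OF assms(1)] ..
  finally show ?thesis .
qed

text \<open>The roots used by \<open>growth_constant\<close> depend on the graph, so only the
  existence of some \<open>R\<close> is recorded; the later union bound runs over all
  candidates.\<close>

lemma large_growth_constant_imp_large_volume:
  assumes fin: "finite_graph G" and b: "0 \<le> b" "b < ln (growth_constant G)"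
  shows "\<exists>R. is_root_set G R \<and> exp (b * (real (card (verts G)) - real (card R))) \<le> polytope_volume G R"
proof -
  define R where "R = (SOME R. is_root_set G R)"
  have R: "is_root_set G R" unfolding R_def by (rule someI_ex[OF ex_is_root_set])
  have le: "card R \<le> card (verts G)"
    using R fin by (intro card_mono) (auto simp: is_root_set_def finite_graph_def)
  have k: "card (graph_components G) = card R" using card_root_set[OF R] by simp
  \<comment> \<open>In the degenerate case the constant is 1 by convention, and its logarithm 0 does
    not exceed \<open>b\<close>.\<close>
  have "card (verts G) \<noteq> card (graph_components G)"
    using b by (auto simp: growth_constant_def)
  then have lt: "card (graph_components G) < card (verts G)" using le k by simp
  let ?c = "growth_constant G" and ?m = "card (verts G) - card R"
  have c: "0 < ?c" "?c ^ ?m = polytope_volume G R"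
    using growth_constant[OF fin lt] unfolding k R_def by auto
  have "exp (b * (real (card (verts G)) - real (card R))) = exp (real ?m * b)"
    using le by (simp add: of_nat_diff mult.commute)
  also have "\<dots> \<le> exp (real ?m * ln ?c)" using b by (intro exp_le_cancel_iff[THEN iffD2] mult_left_mono) auto
  also have "\<dots> = ?c ^ ?m" using c(1) by (simp add: exp_of_nat_mult)
  finally show ?thesis using R c(2) by auto
qed

text \<open>Either there are more than \<open>\<delta> * n\<close> roots, or some root set of at
  most that size has a large volume. In the second rate, \<open>9 / 4 * d + 1\<close> collects
  \<open>d / 4 + 1\<close> from the number of small root sets, counted with \<open>s = d / 4\<close>
  so that \<open>exp (- s) = \<delta>\<close>, and \<open>2 * d\<close> from the far
  vertices.\<close>

lemma prob_large_growth_constant_le: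
  fixes d b :: real and n :: nat
  assumes d: "1 \<le> d" and dn: "d < real n" and b: "0 \<le> b"
  defines "\<delta> \<equiv> exp (- (d / 4))"
  shows "measure_pmf.prob (erdos_renyi n (d / real n)) {G. b < ln (growth_constant G)}
    \<le> exp 1 * exp (- (\<delta> / 2 - exp (1 - d / 2)) * real n) +
      real (2 * n ^ 3 + 2) * (real n + 1) * exp 1 *
        exp (- (b * (1 - \<delta>) - pi\<^sup>2 / (6 * d) - \<delta> * (9 / 4 * d + 1)) * real n)"
proof -
  define p where "p = d / real n"
  have n: "0 < n" using d dn by (cases n) auto
  have p: "0 < p" "p < 1" using d dn by (simp_all add: p_def)
  have pn: "p * real n = d" using n by (simp add: p_def)
  have \<delta>: "0 < \<delta>" "\<delta> < 1" using d by (simp_all add: \<delta>_def)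
  let ?V = "{1..n}" and ?G = "edge_graph n" and ?\<mu> = "random_edges n p"
  \<comment> \<open>More than \<open>\<delta> * n\<close> roots are at least \<open>2 * a\<close>
    roots; rounding down costs the factor \<open>exp 1\<close> in the first error term.\<close>
  define a where "a = nat \<lfloor>\<delta> * real n / 2\<rfloor>"
  define J where "J = {R. R \<subseteq> ?V \<and> real (card R) \<le> \<delta> * real n}"
  define E1 where "E1 = {X. \<exists>R. is_root_set (?G X) R \<and> 2 * a \<le> card R}"
  define F where "F R = {X. is_root_set (?G X) R \<and> exp (b * (1 - \<delta>) * real n) \<le> polytope_volume (?G X) R}" for R
  have finJ: "finite J" by (simp add: J_def)
  have a: "real a \<le> \<delta> * real n / 2" "\<delta> * real n / 2 - 1 \<le> real a"
  proof -
    have "0 \<le> \<delta> * real n / 2" using \<delta> by simp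
    then have "real a = real_of_int \<lfloor>\<delta> * real n / 2\<rfloor>" unfolding a_def by simp
    then show "real a \<le> \<delta> * real n / 2" "\<delta> * real n / 2 - 1 \<le> real a" by linarith+
  qed
  have sub: "?G -` {G. b < ln (growth_constant G)} \<subseteq> E1 \<union> (\<Union>R\<in>J. F R)"
  proof
    fix X assume "X \<in> ?G -` {G. b < ln (growth_constant G)}"
    then have "b < ln (growth_constant (?G X))" by simp
    from large_growth_constant_imp_large_volume[OF finite_graph_edge_graph b this]
    obtain R where R: "is_root_set (?G X) R"
      and vol: "exp (b * (real n - real (card R))) \<le> polytope_volume (?G X) R" by auto
    show "X \<in> E1 \<union> (\<Union>R\<in>J. F R)"
    proof (cases "real (card R) \<le> \<delta> * real n")
      case True
      have "R \<subseteq> ?V" using R by (simp add: is_root_set_def)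
      then have RJ: "R \<in> J" using True by (simp add: J_def)
      have "exp (b * (1 - \<delta>) * real n) \<le> exp (b * (real n - real (card R)))"
      proof -
        have "(1 - \<delta>) * real n \<le> real n - real (card R)" using True by (simp add: left_diff_distrib)
        from mult_left_mono[OF this b] show ?thesis by (simp add: mult.assoc)
      qed
      also note vol
      finally have "X \<in> F R" using R by (simp add: F_def)
      then show ?thesis using RJ by blast
    next
      case False
      then have "real (2 * a) \<le> real (card R)" using a by simp
      then have "2 * a \<le> card R" by (simp only: of_nat_le_iff)
      then show ?thesis using R unfolding E1_def by blast
    qed
  qed
  have "measure_pmf.prob (erdos_renyi n (d / real n)) {G. b < ln (growth_constant G)}
      = measure_pmf.prob ?\<mu> (?G -` {G. b < ln (growth_constant G)})"
    by (simp add: erdos_renyi_conv p_def)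
  also have "\<dots> \<le> measure_pmf.prob ?\<mu> (E1 \<union> (\<Union>R\<in>J. F R))"
    by (intro measure_pmf.finite_measure_mono sub) auto
  also have "\<dots> \<le> measure_pmf.prob ?\<mu> E1 + measure_pmf.prob ?\<mu> (\<Union>R\<in>J. F R)"
    by (intro measure_Un_le) auto
  also have "\<dots> \<le> measure_pmf.prob ?\<mu> E1 + (\<Sum>R\<in>J. measure_pmf.prob ?\<mu> (F R))"
    using finJ by (intro add_left_mono measure_pmf.finite_measure_subadditive_finite) auto
  also have "\<dots> \<le> exp 1 * exp (- (\<delta> / 2 - exp (1 - d / 2)) * real n) +
      real (2 * n ^ 3 + 2) * (real n + 1) * exp 1 *
        exp (- (b * (1 - \<delta>) - pi\<^sup>2 / (6 * d) - \<delta> * (9 / 4 * d + 1)) * real n)"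
  proof (rule add_mono)
    have pow: "(1 + y) ^ n \<le> exp (y * real n)" if "0 \<le> y" for y :: real
    proof -
      have "(1 + y) ^ n \<le> exp y ^ n" using that exp_ge_add_one_self[of y] by (intro power_mono) auto
      then show ?thesis by (simp add: exp_of_nat_mult mult.commute[of y])
    qed
    have "measure_pmf.prob ?\<mu> E1 \<le> exp (- real a) * (1 + exp (1 - d / 2)) ^ n"
      using prob_many_roots_le[of p n a] p unfolding E1_def pn by simp
    also have "\<dots> \<le> exp (1 - \<delta> * real n / 2) * exp (exp (1 - d / 2) * real n)"
      using a by (intro mult_mono pow) auto
    also have "\<dots> = exp 1 * exp (- (\<delta> / 2 - exp (1 - d / 2)) * real n)"
      unfolding exp_add[symmetric] by (simp add: algebra_simps)
    finally show "measure_pmf.prob ?\<mu> E1 \<le> exp 1 * exp (- (\<delta> / 2 - exp (1 - d / 2)) * real n)" .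
    let ?P = "real (2 * n ^ 3 + 2) * (real n + 1) * exp 1"
    have "(\<Sum>R\<in>J. measure_pmf.prob ?\<mu> (F R)) \<le>
        (\<Sum>R\<in>J. ?P * exp (pi\<^sup>2 / (6 * p)) * (1 + 2 * d * \<delta>) ^ n * exp (- (b * (1 - \<delta>) * real n)))"
    proof (rule sum_mono)
      fix R
      from prob_large_volume_le[where R = R and b = "b * (1 - \<delta>) * real n", OF p n]
      show "measure_pmf.prob ?\<mu> (F R) \<le> ?P * exp (pi\<^sup>2 / (6 * p)) * (1 + 2 * d * \<delta>) ^ n * exp (- (b * (1 - \<delta>) * real n))"
        unfolding F_def pn \<delta>_def using d by simp
    qed
    also have "\<dots> = real (card J) * (?P * exp (pi\<^sup>2 / (6 * p)) * (1 + 2 * d * \<delta>) ^ n * exp (- (b * (1 - \<delta>) * real n)))"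
      by simp
    also have "\<dots> \<le> (exp (d / 4 * (\<delta> * real n)) * exp (\<delta> * real n)) *
        (?P * exp (pi\<^sup>2 / (6 * p)) * exp (2 * d * \<delta> * real n) * exp (- (b * (1 - \<delta>) * real n)))"
    proof (intro mult_mono order_refl pow)
      have "real (card J) \<le> exp (d / 4 * (\<delta> * real n)) * (1 + \<delta>) ^ n"
        using card_small_subsets_le[of ?V "d / 4" "\<delta> * real n"] d unfolding J_def \<delta>_def by simp
      also have "\<dots> \<le> exp (d / 4 * (\<delta> * real n)) * exp (\<delta> * real n)"
        using \<delta> by (intro mult_left_mono pow) auto
      finally show "real (card J) \<le> exp (d / 4 * (\<delta> * real n)) * exp (\<delta> * real n)" .
    qed (use \<delta> d in auto)
    also have "\<dots> = ?P * exp (d / 4 * (\<delta> * real n) + \<delta> * real n + pi\<^sup>2 / (6 * p) + 2 * d * \<delta> * real n - b * (1 - \<delta>) * real n)"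
      by (simp only: exp_add exp_diff exp_minus divide_inverse ac_simps)
    also have "d / 4 * (\<delta> * real n) + \<delta> * real n + pi\<^sup>2 / (6 * p) + 2 * d * \<delta> * real n - b * (1 - \<delta>) * real n
        = - (b * (1 - \<delta>) - pi\<^sup>2 / (6 * d) - \<delta> * (9 / 4 * d + 1)) * real n"
      using d n by (simp add: p_def algebra_simps)
    finally show "(\<Sum>R\<in>J. measure_pmf.prob ?\<mu> (F R)) \<le> ?P *
        exp (- (b * (1 - \<delta>) - pi\<^sup>2 / (6 * d) - \<delta> * (9 / 4 * d + 1)) * real n)" .
  qed
  finally show ?thesis .
qed

theorem theorem4p6:
  fixes \<epsilon> :: real
  assumes "\<epsilon> > 0"
  shows "\<exists>d0::real. d0 > 0 \<and> (\<forall>d\<ge>d0.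
           (\<lambda>n. measure_pmf.prob (erdos_renyi n (d / real n))
                  {G. ln (growth_constant G) \<le> (pi\<^sup>2 / 6 + \<epsilon>) / d}) \<longlonglongrightarrow> 1)"
proof -
  \<comment> \<open>The two conditions on \<open>d\<close> say that the exponential rates
    \<open>g1\<close> and \<open>g2\<close> below are positive; the second is
    \<open>d * g2 > 0\<close> multiplied out. All error terms in it carry the factor
    \<open>exp (- d / 4)\<close> and vanish as \<open>d\<close> grows.\<close>
  have "eventually (\<lambda>d::real. exp (1 - d / 2) < exp (- (d / 4)) / 2) at_top"
    by real_asymp
  moreover have "((\<lambda>d::real. exp (- (d / 4)) * (pi\<^sup>2 / 6 + \<epsilon>) + d * (exp (- (d / 4)) * (9 / 4 * d + 1))) \<longlongrightarrow> 0) at_top"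
    by real_asymp
  then have "eventually (\<lambda>d::real. exp (- (d / 4)) * (pi\<^sup>2 / 6 + \<epsilon>) + d * (exp (- (d / 4)) * (9 / 4 * d + 1)) < \<epsilon>) at_top"
    using assms by (rule order_tendstoD)
  moreover have "eventually (\<lambda>d::real. 1 \<le> d) at_top" by (rule eventually_ge_at_top)
  ultimately have "eventually (\<lambda>d::real. exp (1 - d / 2) < exp (- (d / 4)) / 2 \<and>
      exp (- (d / 4)) * (pi\<^sup>2 / 6 + \<epsilon>) + d * (exp (- (d / 4)) * (9 / 4 * d + 1)) < \<epsilon> \<and> 1 \<le> d) at_top"
    by eventually_elim simp
  then obtain d0 where d0: "\<And>d. d \<ge> d0 \<Longrightarrow> exp (1 - d / 2) < exp (- (d / 4)) / 2 \<and>
      exp (- (d / 4)) * (pi\<^sup>2 / 6 + \<epsilon>) + d * (exp (- (d / 4)) * (9 / 4 * d + 1)) < \<epsilon> \<and> 1 \<le> d"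
    unfolding eventually_at_top_linorder by blast
  show ?thesis
  proof (intro exI[of _ d0] conjI allI impI)
    show "d0 > 0" using d0[of d0] by simp
    fix d assume "d \<ge> d0"
    note d = d0[OF this]
    let ?\<delta> = "exp (- (d / 4))"
    define b where "b = (pi\<^sup>2 / 6 + \<epsilon>) / d"
    have d1: "1 \<le> d" using d by simp
    have b0: "0 \<le> b" using d1 assms by (simp add: b_def)
    define g1 where "g1 = ?\<delta> / 2 - exp (1 - d / 2)"
    define g2 where "g2 = b * (1 - ?\<delta>) - pi\<^sup>2 / (6 * d) - ?\<delta> * (9 / 4 * d + 1)"
    have g1: "g1 > 0" using d by (simp add: g1_def)
    have "d * g2 = \<epsilon> - (?\<delta> * (pi\<^sup>2 / 6 + \<epsilon>) + d * (?\<delta> * (9 / 4 * d + 1)))"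
      using d1 by (simp add: g2_def b_def field_simps)
    then have "d * g2 > 0" using d by linarith
    then have g2: "g2 > 0" using d1 by (simp add: zero_less_mult_iff)
    define err where "err n = exp 1 * exp (- g1 * real n) +
      real (2 * n ^ 3 + 2) * (real n + 1) * exp 1 * exp (- g2 * real n)" for n
    have "(\<lambda>n. exp 1 * exp (- g1 * real n)) \<longlonglongrightarrow> 0"
      using g1 by real_asymp
    moreover have "(\<lambda>n. real (2 * n ^ 3 + 2) * (real n + 1) * exp 1 * exp (- g2 * real n)) \<longlonglongrightarrow> 0"
      using g2 by real_asymp
    ultimately have "(\<lambda>n. 1 - err n) \<longlonglongrightarrow> 1 - (0 + 0)"
      unfolding err_def by (intro tendsto_diff tendsto_add tendsto_const)
    then have lim: "(\<lambda>n. 1 - err n) \<longlonglongrightarrow> 1" by simp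
    have ev: "\<forall>\<^sub>F n in sequentially. 1 - err n \<le>
        measure_pmf.prob (erdos_renyi n (d / real n)) {G. ln (growth_constant G) \<le> b}"
      \<comment> \<open>Beyond this point \<open>d / n\<close> is less than 1 and hence a genuine
        edge probability.\<close>
      using eventually_gt_at_top[of "nat \<lceil>d\<rceil>"]
    proof eventually_elim
      case (elim n)
      then have dn: "d < real n" by linarith
      have "measure_pmf.prob (erdos_renyi n (d / real n)) {G. ln (growth_constant G) \<le> b}
        = 1 - measure_pmf.prob (erdos_renyi n (d / real n)) {G. b < ln (growth_constant G)}"
        using measure_pmf.prob_compl[of "{G. b < ln (growth_constant G)}" "erdos_renyi n (d / real n)"]
        by (simp add: Collect_neg_eq[symmetric] not_less flip: Compl_eq_Diff_UNIV)
      then show ?case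
        using prob_large_growth_constant_le[OF d1 dn b0] unfolding err_def g1_def g2_def by simp
    qed
    show "(\<lambda>n. measure_pmf.prob (erdos_renyi n (d / real n))
        {G. ln (growth_constant G) \<le> (pi\<^sup>2 / 6 + \<epsilon>) / d}) \<longlonglongrightarrow> 1"
      unfolding b_def[symmetric]
      by (rule tendsto_sandwich[OF ev _ lim tendsto_const]) simp
  qed
qed

end
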